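(* Let $p\in(0,1)$ and $z>0$, and let $$(A,B)\overset{d}{=}I_p(1-L,0)+(1-I_p)(1,R),$$ where $I_p\sim Be(p)$ is independent of the $[0,1)^2$-valued random vector $(L,R)$ and $L\overset{d}{=}R\sim\beta(1,z)$. Set $(a,b)=((1-p)z,\,pz)$. Then all of the following hold. (i) For $V_2\sim\Gamma_b$, $V_1\sim\Gamma_a$ is the unique (in distribution) solution to $V_1\overset{d}{=}AV_1+BV_2$, where $V_1,V_2,(A,B)$ are mutually independent. (ii) $X\sim\beta(a,b)$ is the unique (in distribution) solution to $X\overset{d}{=}AX+B(1-X)$, where $X$ is independent of $(A,B)$. (iii) There is a random variable $Y\sim\beta(a,b)$ such that, as $n\to\infty$, $Y_n(x)\to Y$ almost surely, uniformly in $x\in[0,1]$. (iv) For every $x\in[0,1]$, $X_n(x)$ converges in distribution to $\beta(a,b)$ as $n\to\infty$. (v) For every $x'\in(0,\infty)$, $X'_n(x')$ converges in distribution to $\Gamma_a$ as $n\to\infty$.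
   Context: $\overset{d}{=}$ denotes equality in distribution. $Be(p)$ is the Bernoulli distribution with success probability $p$. $\beta(a,b)$, $a,b>0$, is the beta distribution with density $B(a,b)^{-1}u^{a-1}(1-u)^{b-1}$ on $(0,1)$. $\Gamma_a$, $a>0$, is the gamma distribution with shape $a$ and scale $1$. $F_1\otimes F_2$ denotes the joint law of independent random elements with laws $F_1$, $F_2$. A solution of a random equation is a real random variable (or its law) satisfying it; uniqueness is in distribution. No assumption is made on the dependence between $L$ and $R$. Let $\mu$ be the law of $(A,B)$ and let $(A_1,B_1,V_1),(A_2,B_2,V_2),\dots$ be i.i.d. with law $\mu\otimes\Gamma_b$. Put $F_n(x)=A_nx+B_n(1-x)$ for $x\in[0,1]$ and $G_n(x')=A_nx'+B_nV_n$ for $x'\in(0,\infty)$. Define, for $n\ge1$, $X_n=F_n\circ F_{n-1}\circ\cdots\circ F_1$ (forward iteration), $Y_n=F_1\circ F_2\circ\cdots\circ F_n$ (backward iteration), and $X'_n=G_n\circ G_{n-1}\circ\cdots\circ G_1$. *)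

theory Defs
  imports "HOL-Probability.Probability"
begin

definition bernoulli_law :: "real \<Rightarrow> real measure" where
  "bernoulli_law p = distr (measure_pmf (bernoulli_pmf p)) borel of_bool"

definition beta_law :: "real \<Rightarrow> real \<Rightarrow> real measure" where
  "beta_law a b = density lborel
     (\<lambda>u. ennreal (indicator {0<..<1} u * u powr (a - 1) * (1 - u) powr (b - 1) / Beta a b))"

definition gamma_law :: "real \<Rightarrow> real measure" where
  "gamma_law a = density lborel
     (\<lambda>t. ennreal (indicator {0<..} t * t powr (a - 1) * exp (- t) / Gamma a))"

lemma prob_space_gamma_law:
  assumes "a > 0"
  shows "prob_space (gamma_law a)"
proof (rule prob_spaceI)
  have "emeasure (gamma_law a) (space (gamma_law a)) =
      (\<integral>\<^sup>+t. ennreal (indicator {0<..} t * t powr (a - 1) * exp (- t) / Gamma a) \<partial>lborel)"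
    by (simp add: gamma_law_def emeasure_density)
  also have "\<dots> = (\<integral>\<^sup>+t. ennreal (1 / Gamma a) *
      ennreal (indicator {0..} t * t powr (a - 1) / exp t) \<partial>lborel)"
    using assms
    by (intro nn_integral_cong)
       (auto simp: indicator_def exp_minus field_simps Gamma_real_pos less_imp_le
             simp flip: ennreal_mult')
  also have "\<dots> = ennreal (1 / Gamma a) * ennreal (Gamma a)"
    using Gamma_conv_nn_integral_real[OF assms]
    by (subst nn_integral_cmult) (auto simp: nn_integral_completion)
  also have "\<dots> = 1"
    using Gamma_real_pos[OF assms] by (simp flip: ennreal_mult')
  finally show "emeasure (gamma_law a) (space (gamma_law a)) = 1" .
qed

lemma prob_space_beta_law:
  assumes "a > 0" "b > 0"
  shows "prob_space (beta_law a b)"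
proof (rule prob_spaceI)
  let ?f = "\<lambda>u::real. u powr (a - 1) * (1 - u) powr (b - 1)"
  have B: "Beta a b > 0"
    using assms by (simp add: Beta_def Gamma_real_pos)
  have I: "(\<integral>\<^sup>+u. ennreal (indicator {0..1} u * ?f u) \<partial>lborel) = ennreal (Beta a b)"
    by (rule nn_integral_has_integral_lebesgue)
       (use has_integral_Beta_real[OF assms] in auto)
  have "emeasure (beta_law a b) (space (beta_law a b)) =
      (\<integral>\<^sup>+u. ennreal (indicator {0<..<1} u * u powr (a - 1) * (1 - u) powr (b - 1) / Beta a b)
         \<partial>lborel)"
    by (simp add: beta_law_def emeasure_density)
  also have "\<dots> = (\<integral>\<^sup>+u. ennreal (1 / Beta a b) * ennreal (indicator {0..1} u * ?f u) \<partial>lborel)"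
  proof (intro nn_integral_cong)
    fix u :: real
    show "ennreal (indicator {0<..<1} u * u powr (a - 1) * (1 - u) powr (b - 1) / Beta a b) =
        ennreal (1 / Beta a b) * ennreal (indicator {0..1} u * ?f u)"
      using B by (cases "u = 0 \<or> u = 1") (auto simp: indicator_def simp flip: ennreal_mult')
  qed
  also have "\<dots> = ennreal (1 / Beta a b) * ennreal (Beta a b)"
    by (subst nn_integral_cmult) (auto simp: I)
  also have "\<dots> = 1"
    using B by (simp flip: ennreal_mult')
  finally show "emeasure (beta_law a b) (space (beta_law a b)) = 1" .
qed

definition beta_map :: "real \<times> real \<Rightarrow> real \<Rightarrow> real" where
  "beta_map = (\<lambda>(a, b) x. a * x + b * (1 - x))"

definition gamma_map :: "(real \<times> real) \<times> real \<Rightarrow> real \<Rightarrow> real" where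
  "gamma_map = (\<lambda>((a, b), v) x. a * x + b * v)"

text \<open>\<open>\<eta>\<close> is the law of some real \<open>X\<close> with \<open>X = \<Phi> S X\<close> in distribution, where \<open>S\<close> has
  law \<open>\<nu>\<close> and is independent of \<open>X\<close>.\<close>

definition solves_random_equation ::
    "'s measure \<Rightarrow> ('s \<Rightarrow> real \<Rightarrow> real) \<Rightarrow> real measure \<Rightarrow> bool" where
  "solves_random_equation \<nu> \<Phi> \<eta> \<longleftrightarrow>
     real_distribution \<eta> \<and> \<eta> = distr (\<eta> \<Otimes>\<^sub>M \<nu>) borel (\<lambda>(x, s). \<Phi> s x)"

text \<open>Iterations start from the map with index 1; the map \<open>f 0\<close> is never used.\<close>

primrec forward_iter :: "(nat \<Rightarrow> 'a \<Rightarrow> 'a) \<Rightarrow> nat \<Rightarrow> 'a \<Rightarrow> 'a" where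
  "forward_iter f 0 = id"
| "forward_iter f (Suc n) = f (Suc n) \<circ> forward_iter f n"

primrec backward_iter :: "(nat \<Rightarrow> 'a \<Rightarrow> 'a) \<Rightarrow> nat \<Rightarrow> 'a \<Rightarrow> 'a" where
  "backward_iter f 0 = id"
| "backward_iter f (Suc n) = backward_iter f n \<circ> f (Suc n)"

end

theory Submission
  imports Defs
begin

text \<open>If \<open>U\<close> has law \<open>\<beta>(a + b, 1)\<close> and is independent of \<open>X\<close> with law \<open>\<beta>(a, b)\<close>, then \<open>X U\<close> has law
  \<open>\<beta>(a, b + 1)\<close>; by the symmetry \<open>x \<mapsto> 1 - x\<close>, \<open>1 - (1 - X) U\<close> has law \<open>\<beta>(a + 1, b)\<close>. The mixture of these
  two laws with weights \<open>b / (a + b) = p\<close> and \<open>a / (a + b) = 1 - p\<close> is \<open>\<beta>(a, b)\<close> again, which is the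
  beta equation. Multiplying it by an independent gamma variable of shape \<open>z = a + b\<close> gives the
  gamma equation. All the random maps are affine with a slope \<open>\<alpha>\<close> such that \<open>E \<bar>\<alpha>\<bar> < 1\<close>, so they contract
  differences of characteristic functions; this yields uniqueness and the weak limits. The
  backward iterations converge because the products of the slopes are summable almost surely,
  and they have the same laws as the forward iterations.\<close>

section \<open>Beta and gamma laws\<close>

text \<open>The real function under \<open>ennreal\<close> in \<open>beta_law\<close>, named
  separately so that identities between densities can be proved by real arithmetic before they are
  moved to \<open>ennreal\<close>.\<close>

definition beta_dens :: "real \<Rightarrow> real \<Rightarrow> real \<Rightarrow> real" where
  "beta_dens a b u = indicator {0<..<1} u * u powr (a - 1) * (1 - u) powr (b - 1) / Beta a b"

definition gamma_dens :: "real \<Rightarrow> real \<Rightarrow> real" where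
  "gamma_dens a t = indicator {0<..} t * t powr (a - 1) * exp (- t) / Gamma a"

lemma beta_dens_measurable [measurable]: "beta_dens a b \<in> borel_measurable borel"
  unfolding beta_dens_def by measurable

lemma gamma_dens_measurable [measurable]: "gamma_dens a \<in> borel_measurable borel"
  unfolding gamma_dens_def by measurable

lemma Beta_real_pos: "0 < a \<Longrightarrow> 0 < b \<Longrightarrow> 0 < Beta a (b::real)"
  by (simp add: Beta_def Gamma_real_pos)

lemma beta_dens_nonneg: "0 < a \<Longrightarrow> 0 < b \<Longrightarrow> 0 \<le> beta_dens a b u"
  by (simp add: beta_dens_def Beta_real_pos less_imp_le)

lemma gamma_dens_nonneg: "0 < a \<Longrightarrow> 0 \<le> gamma_dens a t"
  by (simp add: gamma_dens_def Gamma_real_pos less_imp_le)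

lemma beta_law_altdef: "beta_law a b = density lborel (\<lambda>u. ennreal (beta_dens a b u))"
  by (simp add: beta_law_def beta_dens_def)

lemma gamma_law_altdef: "gamma_law a = density lborel (\<lambda>u. ennreal (gamma_dens a u))"
  by (simp add: gamma_law_def gamma_dens_def)

lemma sets_beta_law [simp, measurable_cong]: "sets (beta_law a b) = sets borel"
  by (simp add: beta_law_def)

lemma space_beta_law [simp]: "space (beta_law a b) = UNIV"
  by (simp add: beta_law_def)

lemma sets_gamma_law [simp, measurable_cong]: "sets (gamma_law a) = sets borel"
  by (simp add: gamma_law_def)

lemma space_gamma_law [simp]: "space (gamma_law a) = UNIV"
  by (simp add: gamma_law_def)

lemma real_distribution_beta_law: "0 < a \<Longrightarrow> 0 < b \<Longrightarrow> real_distribution (beta_law a b)"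
  by (simp add: real_distribution_def real_distribution_axioms_def prob_space_beta_law)

lemma real_distribution_gamma_law: "0 < a \<Longrightarrow> real_distribution (gamma_law a)"
  by (simp add: real_distribution_def real_distribution_axioms_def prob_space_gamma_law)

lemma nn_integral_beta_law:
  assumes "f \<in> borel_measurable borel"
  shows "(\<integral>\<^sup>+u. f u \<partial>beta_law a b) = (\<integral>\<^sup>+u. ennreal (beta_dens a b u) * f u \<partial>lborel)"
  using assms by (simp add: beta_law_altdef nn_integral_density)

lemma nn_integral_gamma_law:
  assumes "f \<in> borel_measurable borel"
  shows "(\<integral>\<^sup>+u. f u \<partial>gamma_law a) = (\<integral>\<^sup>+u. ennreal (gamma_dens a u) * f u \<partial>lborel)"
  using assms by (simp add: gamma_law_altdef nn_integral_density)

lemma AE_beta_law: "AE u in beta_law a b. 0 < u \<and> u < 1"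
  unfolding beta_law_altdef by (subst AE_density) (auto simp: beta_dens_def indicator_def)

text \<open>The substitution of \<open>1 - u\<close> for \<open>u\<close> exchanges the two power
  factors of the density, and \<open>Beta\<close> is symmetric. Facts about the first parameter are
  transferred to the second one in this way.\<close>

lemma nn_integral_beta_law_reflect:
  assumes [measurable]: "f \<in> borel_measurable borel"
  shows "(\<integral>\<^sup>+u. f (1 - u) \<partial>beta_law a b) = (\<integral>\<^sup>+u. f u \<partial>beta_law b a)"
proof -
  have "beta_dens a b (1 - u) = beta_dens b a u" for u
    by (auto simp: beta_dens_def indicator_def Beta_commute)
  then have "(\<integral>\<^sup>+u. ennreal (beta_dens b a u) * f u \<partial>lborel) =
      (\<integral>\<^sup>+u. ennreal (beta_dens a b (1 - u)) * f u \<partial>lborel)"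
    by simp
  also have "\<dots> = (\<integral>\<^sup>+u. ennreal (beta_dens a b u) * f (1 - u) \<partial>lborel)"
    by (subst nn_integral_real_affine[where c = "-1" and t = 1]) auto
  finally show ?thesis
    by (simp add: nn_integral_beta_law)
qed

section \<open>Parameter shifts of the beta density\<close>

lemma nonpos_Ints_pos_real: "(0::real) < x \<Longrightarrow> x \<notin> \<int>\<^sub>\<le>\<^sub>0"
  by (auto elim!: nonpos_Ints_cases)

text \<open>Size biasing: a factor \<open>u\<close> raises the first exponent by one, and the
  recurrence of \<open>Beta\<close> supplies the new normalisation.\<close>

lemma beta_dens_plus1_left:
  assumes "0 < a" "0 < b"
  shows "a * beta_dens (a + 1) b u = (a + b) * u * beta_dens a b u"
proof (cases "0 < u \<and> u < 1")
  case True
  have "(a + b) * Beta (a + 1) b = a * Beta a b"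
    using assms by (intro Beta_plus1_left nonpos_Ints_pos_real)
  moreover have "0 < Beta a b" "0 < Beta (a + 1) b"
    using assms by (simp_all add: Beta_real_pos)
  ultimately have "a / Beta (a + 1) b = (a + b) / Beta a b"
    using assms by (simp add: frac_eq_eq mult.commute)
  moreover have "u powr a = u * u powr (a - 1)"
    using True powr_mult_base[of u "a - 1"] by simp
  moreover have "a * beta_dens (a + 1) b u =
      a / Beta (a + 1) b * (u powr a * (1 - u) powr (b - 1))"
    using True by (simp add: beta_dens_def)
  ultimately show ?thesis
    using True by (simp add: beta_dens_def)
qed (auto simp: beta_dens_def)

lemma beta_dens_plus1_right:
  assumes "0 < a" "0 < b"
  shows "b * beta_dens a (b + 1) u = (a + b) * (1 - u) * beta_dens a b u"
proof -
  have reflect: "beta_dens a b u = beta_dens b a (1 - u)" for a b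
    by (auto simp: beta_dens_def indicator_def Beta_commute)
  show ?thesis
    using beta_dens_plus1_left[of b a "1 - u"] assms by (simp add: reflect[of a] add.commute)
qed

text \<open>By size biasing, the integrand is \<open>a / (a + b)\<close> times the density of
  another beta law, whose total mass is 1. This mean later bounds the expected slopes of the random
  maps.\<close>

lemma nn_integral_id_beta_law:
  assumes "0 < a" "0 < b"
  shows "(\<integral>\<^sup>+u. ennreal u \<partial>beta_law a b) = ennreal (a / (a + b))"
proof -
  interpret prob_space "beta_law (a + 1) b"
    using assms by (intro prob_space_beta_law) auto
  have "(\<integral>\<^sup>+u. ennreal u \<partial>beta_law a b) = (\<integral>\<^sup>+u. ennreal (beta_dens a b u) * ennreal u \<partial>lborel)"
    by (simp add: nn_integral_beta_law)
  also have "\<dots> = (\<integral>\<^sup>+u. ennreal (a / (a + b)) * ennreal (beta_dens (a + 1) b u) \<partial>lborel)"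
  proof (intro nn_integral_cong)
    fix u
    have "beta_dens a b u * u = a / (a + b) * beta_dens (a + 1) b u"
      using beta_dens_plus1_left[of a b u] assms by (simp add: field_simps)
    then show "ennreal (beta_dens a b u) * ennreal u =
        ennreal (a / (a + b)) * ennreal (beta_dens (a + 1) b u)"
      using assms by (simp add: beta_dens_nonneg flip: ennreal_mult')
  qed
  also have "\<dots> = ennreal (a / (a + b)) * (\<integral>\<^sup>+u. 1 \<partial>beta_law (a + 1) b)"
    by (subst nn_integral_cmult) (simp_all add: nn_integral_beta_law del: nn_integral_const)
  finally show ?thesis by (simp add: emeasure_space_1[unfolded space_beta_law])
qed

section \<open>Products of independent beta variables\<close>

text \<open>On \<open>(0, 1)\<close> the function \<open>x powr (-b - 1) * (1 - x) powr (b - 1)\<close> has the antiderivative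
  \<open>- ((1 - x) / x) powr b / b\<close>.\<close>

lemma nn_integral_beta_kernel:
  fixes b y :: real
  assumes "0 < b" "0 < y" "y < 1"
  shows "(\<integral>\<^sup>+x. ennreal (indicator {y..1} x * (x powr (- b - 1) * (1 - x) powr (b - 1))) \<partial>lborel)
    = ennreal (((1 - y) / y) powr b / b)"
proof -
  let ?H = "\<lambda>x. - (((1 - x) / x) powr b / b)"
  have "((\<lambda>x. x powr (- b - 1) * (1 - x) powr (b - 1)) has_integral (?H 1 - ?H y)) {y..1}"
  \<comment> \<open>For \<open>b < 1\<close> the integrand blows up at 1, so the derivative is taken
    in the interior only. Since \<open>b > 0\<close>, \<open>?H\<close> is still continuous up to
    1.\<close>
  proof (rule fundamental_theorem_of_calculus_interior)
    show "continuous_on {y..1} ?H"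
      using assms
      by (intro continuous_on_minus continuous_on_divide continuous_on_powr' continuous_intros) auto
    fix x assume x: "x \<in> {y<..<1}"
    then have [simp]: "0 < x" "0 < 1 - x" using assms by auto
    have "(1 - x) powr b = (1 - x) * (1 - x) powr (b - 1)"
      using powr_mult_base[of "1 - x" "b - 1"] x by simp
    moreover have "x powr (- b - 1) = 1 / (x * x powr b)"
      using x assms by (simp add: powr_diff powr_minus_divide)
    ultimately have eq: "((1 - x) / x) powr b * (1 / (x * (1 - x))) =
        x powr (- b - 1) * (1 - x) powr (b - 1)"
      using x by (simp add: powr_divide)
    have "(?H has_real_derivative ((1 - x) / x) powr b * (1 / (x * (1 - x)))) (at x)"
    proof -
      define h where "h = (1 - x) / x"
      have "0 < h" using x by (simp add: h_def)
      then have h: "h powr (b - 1) = h powr b / h"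
        by (simp add: powr_diff)
      have "((\<lambda>x. (1 - x) / x) has_real_derivative - 1 / x\<^sup>2) (at x)"
        using x assms by (auto intro!: derivative_eq_intros simp: power2_eq_square divide_simps)
      from DERIV_minus[OF DERIV_cdivide[OF DERIV_fun_powr[OF this, of b], of b]]
      have "(?H has_real_derivative h powr b / h / x\<^sup>2) (at x)"
        using \<open>0 < h\<close> assms(1) by (simp add: h flip: h_def)
      moreover have "h powr b / h / x\<^sup>2 = h powr b * (1 / (x * (1 - x)))"
        using x by (simp add: h_def power2_eq_square)
      ultimately show ?thesis by (simp add: h_def)
    qed
    then show "(?H has_vector_derivative x powr (- b - 1) * (1 - x) powr (b - 1)) (at x)"
      unfolding eq has_real_derivative_iff_has_vector_derivative .
  qed (use assms in auto)
  from nn_integral_has_integral_lebesgue[OF _ this] show ?thesis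
    using assms by simp
qed

text \<open>Substituting \<open>y = x * u\<close> gives the product the density
  \<open>y \<mapsto> \<integral> ?k x y dx\<close>. Since the second factor has a pure power
  density, the powers of \<open>x\<close> collect into the kernel integrated in
  \<open>nn_integral_beta_kernel\<close>.\<close>

lemma nn_integral_beta_mult:
  fixes f :: "real \<Rightarrow> ennreal"
  assumes ab: "0 < a" "0 < b" and f [measurable]: "f \<in> borel_measurable borel"
  shows "(\<integral>\<^sup>+x. (\<integral>\<^sup>+u. f (x * u) \<partial>beta_law (a + b) 1) \<partial>beta_law a b) =
    (\<integral>\<^sup>+y. f y \<partial>beta_law a (b + 1))"
proof -
  \<comment> \<open>The joint density of \<open>(x, x * u)\<close>; the division by \<open>x\<close>
    is the Jacobian of \<open>u = y / x\<close>.\<close>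
  let ?k = "\<lambda>x y. beta_dens a b x * (beta_dens (a + b) 1 (y / x) / x)"
  have B: "0 < Beta a b" "0 < Beta (a + b) 1" "0 < Beta a (b + 1)"
    using ab by (auto intro!: Beta_real_pos)
  have kernel: "(\<integral>\<^sup>+x. ennreal (?k x y) \<partial>lborel) = ennreal (beta_dens a (b + 1) y)" for y
  proof (cases "0 < y \<and> y < 1")
    case False
    then have k: "?k x y = 0" for x
      by (auto simp: beta_dens_def indicator_def divide_simps)
    show ?thesis
      using False unfolding k by (auto simp: beta_dens_def)
  next
    case True
    let ?c = "y powr (a + b - 1) / (Beta a b * Beta (a + b) 1)"
    have B1: "Beta (a + b) 1 = 1 / (a + b)"
      using ab nonpos_Ints_pos_real[of "a + b"] by (simp add: Beta_def Gamma_plus1 Gamma_eq_zero_iff)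
    have B2: "(a + b) * Beta a (b + 1) = b * Beta a b"
      using ab by (intro Beta_plus1_right nonpos_Ints_pos_real)
    have "(\<integral>\<^sup>+x. ennreal (?k x y) \<partial>lborel) = (\<integral>\<^sup>+x. ennreal ?c *
        ennreal (indicator {y..1} x * (x powr (- b - 1) * (1 - x) powr (b - 1))) \<partial>lborel)"
    \<comment> \<open>The densities are supported on the open interval, the kernel integral runs
      over the closed one. The two endpoints form a null set and are left out.\<close>
    proof (intro nn_integral_cong_AE eventually_mono[OF AE_conjI[OF AE_lborel_singleton[of y] AE_lborel_singleton[of 1]]])
      fix x assume x: "x \<noteq> y \<and> x \<noteq> 1"
      show "ennreal (?k x y) = ennreal ?c *
          ennreal (indicator {y..1} x * (x powr (- b - 1) * (1 - x) powr (b - 1)))"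
      proof (cases "y < x \<and> x < 1")
        case False
        then have "?k x y = 0" "indicator {y..1} x = (0::real)"
          using x True by (auto simp: beta_dens_def indicator_def divide_simps)
        then show ?thesis by auto
      next
        case xy: True
        have "x powr (a - 1) / x powr (a + b - 1) = x powr (- b)"
          by (simp flip: powr_diff)
        moreover have "x powr (- b - 1) = x powr (- b) / x"
          using xy True by (simp add: powr_diff)
        moreover have "?k x y =
            ?c * (x powr (a - 1) / x powr (a + b - 1) / x * (1 - x) powr (b - 1))"
          using xy True by (simp add: beta_dens_def powr_divide mult_ac)
        ultimately have "?k x y = ?c * (x powr (- b - 1) * (1 - x) powr (b - 1))"
          by simp
        then show ?thesis
          using xy B by (simp flip: ennreal_mult')
      qed
    qed
    also have "\<dots> = ennreal ?c * ennreal (((1 - y) / y) powr b / b)"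
      using True ab by (subst nn_integral_cmult) (auto simp: nn_integral_beta_kernel)
    also have "\<dots> = ennreal (?c * (((1 - y) / y) powr b / b))"
      using B by (simp flip: ennreal_mult')
    also have "?c * (((1 - y) / y) powr b / b) = beta_dens a (b + 1) y"
    proof -
      have "y powr (a + b - 1) / y powr b = y powr (a - 1)"
        by (simp flip: powr_diff)
      moreover have "b * (Beta a b * Beta (a + b) 1) = Beta a (b + 1)"
        using B2 ab by (simp add: B1 field_simps)
      ultimately show ?thesis
        using True ab B by (simp add: beta_dens_def powr_divide field_simps)
    qed
    finally show ?thesis .
  qed
  have "(\<integral>\<^sup>+x. (\<integral>\<^sup>+u. f (x * u) \<partial>beta_law (a + b) 1) \<partial>beta_law a b) =
      (\<integral>\<^sup>+x. ennreal (beta_dens a b x) *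
        (\<integral>\<^sup>+u. ennreal (beta_dens (a + b) 1 u) * f (x * u) \<partial>lborel) \<partial>lborel)"
    by (simp add: nn_integral_beta_law)
  also have "\<dots> = (\<integral>\<^sup>+x. (\<integral>\<^sup>+y. ennreal (?k x y) * f y \<partial>lborel) \<partial>lborel)"
  proof (intro nn_integral_cong)
    fix x :: real
    show "ennreal (beta_dens a b x) *
        (\<integral>\<^sup>+u. ennreal (beta_dens (a + b) 1 u) * f (x * u) \<partial>lborel) =
        (\<integral>\<^sup>+y. ennreal (?k x y) * f y \<partial>lborel)"
    proof (cases "0 < x")
      case False
      then show ?thesis by (simp add: beta_dens_def)
    next
      case True
      have "(\<integral>\<^sup>+u. ennreal (beta_dens (a + b) 1 u) * f (x * u) \<partial>lborel) =
          ennreal (1 / x) * (\<integral>\<^sup>+y. ennreal (beta_dens (a + b) 1 (y / x)) * f y \<partial>lborel)"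
        using True by (subst nn_integral_real_affine[where c = "1 / x" and t = 0]) auto
      also have "ennreal (beta_dens a b x) * \<dots> = (\<integral>\<^sup>+y. ennreal (beta_dens a b x) *
          (ennreal (1 / x) * (ennreal (beta_dens (a + b) 1 (y / x)) * f y)) \<partial>lborel)"
        by (simp add: nn_integral_cmult)
      also have "\<dots> = (\<integral>\<^sup>+y. ennreal (?k x y) * f y \<partial>lborel)"
        using True ab
        by (intro nn_integral_cong)
           (simp add: beta_dens_nonneg ennreal_mult'' ennreal_mult' divide_inverse mult_ac)
      finally show ?thesis .
    qed
  qed
  also have "\<dots> = (\<integral>\<^sup>+y. (\<integral>\<^sup>+x. ennreal (?k x y) * f y \<partial>lborel) \<partial>lborel)"
    by (rule lborel_pair.Fubini') measurable
  also have "\<dots> = (\<integral>\<^sup>+y. ennreal (beta_dens a (b + 1) y) * f y \<partial>lborel)"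
    by (simp add: nn_integral_multc kernel del: times_divide_eq_right)
  finally show ?thesis by (simp add: nn_integral_beta_law)
qed

section \<open>Beta-gamma algebra\<close>

text \<open>In the coordinates \<open>w = v + v'\<close> and \<open>x = v / w\<close> the joint
  gamma density factors, so that the sum and the ratio are independent. The constants match because
  \<open>Beta a b = Gamma a * Gamma b / Gamma (a + b)\<close>.\<close>

lemma nn_integral_beta_gamma:
  fixes g :: "real \<times> real \<Rightarrow> ennreal"
  assumes ab: "0 < a" "0 < b" and g [measurable]: "g \<in> borel_measurable (borel \<Otimes>\<^sub>M borel)"
  shows "(\<integral>\<^sup>+v. (\<integral>\<^sup>+v'. g (v, v') \<partial>gamma_law b) \<partial>gamma_law a) =
    (\<integral>\<^sup>+w. (\<integral>\<^sup>+x. g (w * x, w * (1 - x)) \<partial>beta_law a b) \<partial>gamma_law (a + b))"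
proof -
  have G: "0 < Gamma a" "0 < Gamma b" "0 < Gamma (a + b)"
    using ab by (auto intro!: Gamma_real_pos)
  have "(\<integral>\<^sup>+v. (\<integral>\<^sup>+v'. g (v, v') \<partial>gamma_law b) \<partial>gamma_law a) =
      (\<integral>\<^sup>+v. ennreal (gamma_dens a v) *
        (\<integral>\<^sup>+v'. ennreal (gamma_dens b v') * g (v, v') \<partial>lborel) \<partial>lborel)"
    by (simp add: nn_integral_gamma_law)
  also have "\<dots> = (\<integral>\<^sup>+v. ennreal (gamma_dens a v) *
        (\<integral>\<^sup>+w. ennreal (gamma_dens b (w - v)) * g (v, w - v) \<partial>lborel) \<partial>lborel)"
  proof (rule nn_integral_cong)
    fix v :: real
    show "ennreal (gamma_dens a v) *
        (\<integral>\<^sup>+v'. ennreal (gamma_dens b v') * g (v, v') \<partial>lborel) =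
        ennreal (gamma_dens a v) *
        (\<integral>\<^sup>+w. ennreal (gamma_dens b (w - v)) * g (v, w - v) \<partial>lborel)"
      by (subst nn_integral_real_affine[where c = 1 and t = "- v"]) auto
  qed
  also have "\<dots> = (\<integral>\<^sup>+v. (\<integral>\<^sup>+w. ennreal (gamma_dens a v) *
        (ennreal (gamma_dens b (w - v)) * g (v, w - v)) \<partial>lborel) \<partial>lborel)"
    by (simp add: nn_integral_cmult)
  also have "\<dots> = (\<integral>\<^sup>+w. (\<integral>\<^sup>+v. ennreal (gamma_dens a v) *
        (ennreal (gamma_dens b (w - v)) * g (v, w - v)) \<partial>lborel) \<partial>lborel)"
    by (rule lborel_pair.Fubini') measurable
  also have "\<dots> = (\<integral>\<^sup>+w. ennreal (gamma_dens (a + b) w) *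
        (\<integral>\<^sup>+x. ennreal (beta_dens a b x) * g (w * x, w * (1 - x)) \<partial>lborel) \<partial>lborel)"
  proof (intro nn_integral_cong)
    fix w :: real
    show "(\<integral>\<^sup>+v. ennreal (gamma_dens a v) *
        (ennreal (gamma_dens b (w - v)) * g (v, w - v)) \<partial>lborel) =
        ennreal (gamma_dens (a + b) w) *
        (\<integral>\<^sup>+x. ennreal (beta_dens a b x) * g (w * x, w * (1 - x)) \<partial>lborel)"
    proof (cases "0 < w")
      case False
      then have z: "ennreal (gamma_dens a v) * (ennreal (gamma_dens b (w - v)) * g (v, w - v)) = 0" for v
        by (auto simp: gamma_dens_def indicator_def)
      moreover have "gamma_dens (a + b) w = 0"
        using False by (simp add: gamma_dens_def)
      ultimately show ?thesis unfolding z by simp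
    next
      case w: True
      \<comment> \<open>The factor \<open>w\<close> is the Jacobian of \<open>v = w * x\<close>;
        with it the density splits into a function of \<open>w\<close> and one of
        \<open>x\<close>.\<close>
      have dens: "w * (gamma_dens a (w * x) * gamma_dens b (w - w * x)) =
          gamma_dens (a + b) w * beta_dens a b x" for x
      proof (cases "0 < x \<and> x < 1")
        case False
        then have "gamma_dens a (w * x) * gamma_dens b (w - w * x) = 0" "beta_dens a b x = 0"
          using w by (auto simp: gamma_dens_def beta_dens_def indicator_def zero_less_mult_iff)
        then show ?thesis by simp
      next
        case x: True
        have *: "w - w * x = w * (1 - x)" by (simp add: algebra_simps)
        have "w powr (a + b - 1) = w powr (1 + (a - 1) + (b - 1))" by (simp add: algebra_simps)
        then have "w powr (a + b - 1) = w * w powr (a - 1) * w powr (b - 1)"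
          using w by (simp only: powr_add) simp
        moreover have "exp (- w) = exp (- (w * x)) * exp (- (w * (1 - x)))"
          by (simp add: algebra_simps flip: exp_add)
        ultimately show ?thesis
          unfolding * using x w G by (simp add: gamma_dens_def beta_dens_def powr_mult Beta_def)
      qed
      have "(\<integral>\<^sup>+v. ennreal (gamma_dens a v) *
          (ennreal (gamma_dens b (w - v)) * g (v, w - v)) \<partial>lborel) =
          ennreal w * (\<integral>\<^sup>+x. ennreal (gamma_dens a (w * x)) *
          (ennreal (gamma_dens b (w - w * x)) * g (w * x, w - w * x)) \<partial>lborel)"
        using w by (subst nn_integral_real_affine[where c = w and t = 0]) auto
      also have "\<dots> = (\<integral>\<^sup>+x. ennreal w * (ennreal (gamma_dens a (w * x)) *
          (ennreal (gamma_dens b (w - w * x)) * g (w * x, w - w * x))) \<partial>lborel)"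
        by (simp add: nn_integral_cmult)
      also have "\<dots> = (\<integral>\<^sup>+x. ennreal (gamma_dens (a + b) w * beta_dens a b x) *
          g (w * x, w * (1 - x)) \<partial>lborel)"
        using w ab
        by (intro nn_integral_cong)
           (simp add: dens[symmetric] gamma_dens_nonneg ennreal_mult' mult.assoc right_diff_distrib)
      also have "\<dots> = ennreal (gamma_dens (a + b) w) *
          (\<integral>\<^sup>+x. ennreal (beta_dens a b x) * g (w * x, w * (1 - x)) \<partial>lborel)"
        using ab by (simp add: nn_integral_cmult ennreal_mult' gamma_dens_nonneg mult.assoc)
      finally show ?thesis .
    qed
  qed
  also have "\<dots> = (\<integral>\<^sup>+w. (\<integral>\<^sup>+x. g (w * x, w * (1 - x)) \<partial>beta_law a b) \<partial>gamma_law (a + b))"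
    by (simp add: nn_integral_gamma_law nn_integral_beta_law)
  finally show ?thesis .
qed

text \<open>The two shifted densities are multiples of \<open>(1 - u)\<close> and \<open>u\<close>
  times the original one. The weights cancel the multiples, and
  \<open>(1 - u) + u = 1\<close>.\<close>

lemma nn_integral_beta_law_mixture:
  assumes "0 < a" "0 < b" and [measurable]: "f \<in> borel_measurable borel"
  shows "ennreal (b / (a + b)) * (\<integral>\<^sup>+u. f u \<partial>beta_law a (b + 1)) +
    ennreal (a / (a + b)) * (\<integral>\<^sup>+u. f u \<partial>beta_law (a + 1) b) = (\<integral>\<^sup>+u. f u \<partial>beta_law a b)"
proof -
  have dens: "ennreal (beta_dens a b u) = ennreal (b / (a + b)) * ennreal (beta_dens a (b + 1) u) +
      ennreal (a / (a + b)) * ennreal (beta_dens (a + 1) b u)" for u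
  proof -
    have "b / (a + b) * beta_dens a (b + 1) u + a / (a + b) * beta_dens (a + 1) b u =
        ((a + b) * (1 - u) * beta_dens a b u + (a + b) * u * beta_dens a b u) / (a + b)"
      using beta_dens_plus1_left[of a b u] beta_dens_plus1_right[of a b u] assms
      by (simp add: add_divide_distrib)
    also have "\<dots> = beta_dens a b u"
      using assms by (simp add: field_simps)
    finally show ?thesis
      using assms by (simp add: beta_dens_nonneg flip: ennreal_mult' ennreal_plus)
  qed
  show ?thesis
    by (simp add: nn_integral_beta_law dens distrib_right nn_integral_add nn_integral_cmult mult.assoc)
qed

section \<open>Iterated affine random maps\<close>

text \<open>The iterate is regarded as a function of the family of parameters and reads the
  coordinates \<open>1..n\<close> only. Independence of disjoint index blocks can then be applied.
  The set \<open>J\<close> is left general for the sake of the induction.\<close>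

lemma forward_iter_measurable:
  assumes \<Phi> [measurable]: "(\<lambda>(x, s). \<Phi> s x) \<in> borel \<Otimes>\<^sub>M K \<rightarrow>\<^sub>M (borel :: real measure)"
    and "{1..n} \<subseteq> J"
  shows "(\<lambda>f. forward_iter (\<lambda>i. \<Phi> (f i)) n x) \<in> PiM J (\<lambda>_. K) \<rightarrow>\<^sub>M borel"
  using assms(2)
proof (induction n)
  case (Suc n)
  then have [measurable]: "(\<lambda>f. f (Suc n)) \<in> PiM J (\<lambda>_. K) \<rightarrow>\<^sub>M K"
      "(\<lambda>f. forward_iter (\<lambda>i. \<Phi> (f i)) n x) \<in> PiM J (\<lambda>_. K) \<rightarrow>\<^sub>M borel"
    by (auto intro!: measurable_component_singleton simp: subset_iff)
  have "(\<lambda>f. (\<lambda>(x, s). \<Phi> s x) (forward_iter (\<lambda>i. \<Phi> (f i)) n x, f (Suc n)))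
      \<in> PiM J (\<lambda>_. K) \<rightarrow>\<^sub>M borel"
    by measurable
  then show ?case by simp
qed simp

lemma backward_iter_add:
  "backward_iter f (n + m) = backward_iter f n \<circ> backward_iter (\<lambda>i. f (i + n)) m"
  by (induction m) (auto simp: add_ac o_assoc)

text \<open>The recursion of \<open>backward_iter\<close> adds maps on the inside. Peeling off the
  outermost map instead leaves an iteration of the shifted sequence, which explains the shift
  \<open>k\<close> carried below.\<close>

lemma backward_iter_Suc_shift:
  "backward_iter f (Suc n) = f 1 \<circ> backward_iter (\<lambda>i. f (Suc i)) n"
  using backward_iter_add[of f 1 n] by simp

lemma backward_iter_measurable:
  assumes \<Phi> [measurable]: "(\<lambda>(x, s). \<Phi> s x) \<in> borel \<Otimes>\<^sub>M K \<rightarrow>\<^sub>M (borel :: real measure)"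
    and "{k + 1..k + n} \<subseteq> J"
  shows "(\<lambda>f. backward_iter (\<lambda>i. \<Phi> (f (i + k))) n x) \<in> PiM J (\<lambda>_. K) \<rightarrow>\<^sub>M borel"
  using assms(2)
proof (induction n arbitrary: k)
  case (Suc n)
  have "{Suc k + 1..Suc k + n} \<subseteq> J" "Suc k \<in> J"
    using Suc.prems by auto
  note [measurable] = measurable_component_singleton[OF this(2), of "\<lambda>_. K"] Suc.IH[OF this(1)]
  have "(\<lambda>f. (\<lambda>(x, s). \<Phi> s x) (backward_iter (\<lambda>i. \<Phi> (f (i + Suc k))) n x, f (Suc k)))
      \<in> PiM J (\<lambda>_. K) \<rightarrow>\<^sub>M borel"
    by measurable
  then show ?case by (simp add: backward_iter_Suc_shift del: backward_iter.simps)
qed simp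

text \<open>Adding maps on the inside only changes the point of \<open>X\<close> at which the first
  \<open>n\<close> maps are evaluated. All later values therefore stay within \<open>d n\<close> of
  each other, which gives a Cauchy sequence and a limit independent of the starting point.\<close>

lemma uniform_limit_backward_iter:
  fixes g :: "nat \<Rightarrow> real \<Rightarrow> real"
  assumes maps: "\<And>i x. 1 \<le> i \<Longrightarrow> x \<in> X \<Longrightarrow> g i x \<in> X"
    and d: "\<And>n x y. x \<in> X \<Longrightarrow> y \<in> X \<Longrightarrow> \<bar>backward_iter g n x - backward_iter g n y\<bar> \<le> d n"
    and d0: "d \<longlonglongrightarrow> 0" and x0: "x0 \<in> X"
  shows "uniform_limit X (backward_iter g) (\<lambda>_. lim (\<lambda>n. backward_iter g n x0)) sequentially"
proof -
  have in_X: "backward_iter (\<lambda>i. g (i + n)) m x \<in> X" if "x \<in> X" for n m x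
    using that
  proof (induction m arbitrary: x)
    case (Suc m)
    then show ?case using maps[of "Suc m + n" x] by simp
  qed simp
  have near: "\<bar>backward_iter g (n + m) x - backward_iter g n y\<bar> \<le> d n"
    if "x \<in> X" "y \<in> X" for n m x y
    using d[OF in_X[OF that(1)] that(2)] by (simp add: backward_iter_add)
  have "Cauchy (\<lambda>n. backward_iter g n x0)"
  proof (rule metric_CauchyI)
    fix e :: real assume "0 < e"
    then obtain N where N: "d n < e / 2" if "n \<ge> N" for n
      using order_tendstoD(2)[OF d0, of "e / 2"] by (auto simp: eventually_sequentially)
    have "dist (backward_iter g m x0) (backward_iter g n x0) < e" if "m \<ge> N" "n \<ge> N" for m n
      using near[OF x0 x0, of N "m - N"] near[OF x0 x0, of N "n - N"] N[of N] that
      by (simp add: dist_real_def)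
    then show "\<exists>N. \<forall>m\<ge>N. \<forall>n\<ge>N. dist (backward_iter g m x0) (backward_iter g n x0) < e"
      by blast
  qed
  then have lim: "(\<lambda>n. backward_iter g n x0) \<longlonglongrightarrow> lim (\<lambda>n. backward_iter g n x0)"
    by (simp add: Cauchy_convergent_iff convergent_LIMSEQ_iff)
  \<comment> \<open>Letting \<open>m\<close> tend to infinity in \<open>near\<close> yields a bound
    that does not depend on \<open>x\<close>, hence uniform convergence.\<close>
  have bound: "\<bar>backward_iter g n x - lim (\<lambda>n. backward_iter g n x0)\<bar> \<le> d n" if "x \<in> X" for n x
  proof (rule tendsto_upperbound)
    show "(\<lambda>m. \<bar>backward_iter g n x - backward_iter g m x0\<bar>)
        \<longlonglongrightarrow> \<bar>backward_iter g n x - lim (\<lambda>n. backward_iter g n x0)\<bar>"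
      by (intro tendsto_intros lim)
    have "\<bar>backward_iter g n x - backward_iter g m x0\<bar> \<le> d n" if "m \<ge> n" for m
      using near[OF x0 \<open>x \<in> X\<close>, of n "m - n"] that by (simp add: abs_minus_commute)
    then show "\<forall>\<^sub>F m in sequentially. \<bar>backward_iter g n x - backward_iter g m x0\<bar> \<le> d n"
      by (auto simp: eventually_sequentially)
  qed simp
  show ?thesis
  proof (rule uniform_limitI)
    fix e :: real assume "0 < e"
    from order_tendstoD(2)[OF d0 this]
    show "\<forall>\<^sub>F n in sequentially. \<forall>x\<in>X.
        dist (backward_iter g n x) (lim (\<lambda>n. backward_iter g n x0)) < e"
      by eventually_elim (auto simp: dist_real_def intro: le_less_trans[OF bound])
  qed
qed

lemma backward_iter_affine_diff:
  fixes x y :: real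
  assumes "\<And>i x. g i x = c i * x + d i"
  shows "backward_iter g n x - backward_iter g n y = (\<Prod>i=1..n. c i) * (x - y)"
proof (induction n arbitrary: x y)
  case (Suc n)
  have "backward_iter g (Suc n) x - backward_iter g (Suc n) y =
      (\<Prod>i=1..n. c i) * (g (Suc n) x - g (Suc n) y)"
    using Suc.IH by simp
  also have "g (Suc n) x - g (Suc n) y = c (Suc n) * (x - y)"
    by (simp add: assms algebra_simps)
  finally show ?case by simp
qed simp

lemma forward_iter_cong:
  "(\<And>i. 1 \<le> i \<Longrightarrow> i \<le> n \<Longrightarrow> f i = g i) \<Longrightarrow> forward_iter f n = forward_iter g n"
  by (induction n) auto

lemma backward_iter_cong:
  "(\<And>i. 1 \<le> i \<Longrightarrow> i \<le> n \<Longrightarrow> f i = g i) \<Longrightarrow> backward_iter f n = backward_iter g n"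
  by (induction n) auto

section \<open>One random map applied to an independent argument\<close>

text \<open>The transition operator, acting on laws, of the Markov chain driven by
  \<open>\<Phi>\<close>. Solutions of the random equation are its fixed points, and its powers give
  the laws of the iterations.\<close>

definition random_map_law :: "'s measure \<Rightarrow> ('s \<Rightarrow> real \<Rightarrow> real) \<Rightarrow> real measure \<Rightarrow> real measure" where
  "random_map_law \<nu> \<Phi> \<eta> = distr (\<eta> \<Otimes>\<^sub>M \<nu>) borel (\<lambda>(x, s). \<Phi> s x)"

text \<open>The library's \<open>indep_var\<close> relates variables with the same codomain type only.\<close>

lemma (in prob_space) distr_pair_eqI:
  assumes [measurable]: "X \<in> M \<rightarrow>\<^sub>M K" "Y \<in> M \<rightarrow>\<^sub>M L"
    and rect: "\<And>A B. A \<in> sets K \<Longrightarrow> B \<in> sets L \<Longrightarrow>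
      prob ((X -` A \<inter> space M) \<inter> (Y -` B \<inter> space M)) =
      prob (X -` A \<inter> space M) * prob (Y -` B \<inter> space M)"
  shows "distr M (K \<Otimes>\<^sub>M L) (\<lambda>\<omega>. (X \<omega>, Y \<omega>)) = distr M K X \<Otimes>\<^sub>M distr M L Y"
proof (rule pair_measure_eqI[symmetric])
  show "sigma_finite_measure (distr M K X)" "sigma_finite_measure (distr M L Y)"
    by (auto intro!: finite_measure.axioms(1) prob_space.axioms(1) prob_space_distr)
  fix A B assume "A \<in> sets (distr M K X)" "B \<in> sets (distr M L Y)"
  then have [measurable]: "A \<in> sets K" "B \<in> sets L" by auto
  have "(\<lambda>\<omega>. (X \<omega>, Y \<omega>)) -` (A \<times> B) \<inter> space M = (X -` A \<inter> space M) \<inter> (Y -` B \<inter> space M)"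
    by auto
  then show "emeasure (distr M K X) A * emeasure (distr M L Y) B =
      emeasure (distr M (K \<Otimes>\<^sub>M L) (\<lambda>\<omega>. (X \<omega>, Y \<omega>))) (A \<times> B)"
    using rect[of A B] by (simp add: emeasure_distr emeasure_eq_measure ennreal_mult)
qed (simp cong: sets_pair_measure_cong)

text \<open>Events about \<open>f (U \<omega>)\<close> and \<open>g (W \<omega>)\<close> are events
  about \<open>U\<close> and \<open>W\<close>, so the product formula is inherited. In the
  applications \<open>U\<close> and \<open>W\<close> are disjoint blocks of the driving sequence,
  from which \<open>f\<close> computes the current state and \<open>g\<close> the next
  parameter.\<close>

lemma (in prob_space) distr_random_map:
  assumes indep: "indep_var P U Q W"
    and f [measurable]: "f \<in> P \<rightarrow>\<^sub>M borel" and g [measurable]: "g \<in> Q \<rightarrow>\<^sub>M K"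
    and \<Phi> [measurable]: "(\<lambda>(x, s). \<Phi> s x) \<in> borel \<Otimes>\<^sub>M K \<rightarrow>\<^sub>M (borel :: real measure)"
  shows "distr M borel (\<lambda>\<omega>. \<Phi> (g (W \<omega>)) (f (U \<omega>))) =
    random_map_law (distr M K (\<lambda>\<omega>. g (W \<omega>))) \<Phi> (distr M borel (\<lambda>\<omega>. f (U \<omega>)))"
proof -
  have [measurable]: "U \<in> M \<rightarrow>\<^sub>M P" "W \<in> M \<rightarrow>\<^sub>M Q"
    using indep by (auto dest: indep_var_rv1 indep_var_rv2)
  have pair: "distr M (borel \<Otimes>\<^sub>M K) (\<lambda>\<omega>. (f (U \<omega>), g (W \<omega>))) =
      distr M borel (\<lambda>\<omega>. f (U \<omega>)) \<Otimes>\<^sub>M distr M K (\<lambda>\<omega>. g (W \<omega>))"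
  proof (rule distr_pair_eqI)
    fix A :: "real set" and B assume [measurable]: "A \<in> sets borel" "B \<in> sets K"
    have *: "(\<lambda>\<omega>. f (U \<omega>)) -` A \<inter> space M = U -` (f -` A \<inter> space P) \<inter> space M"
        "(\<lambda>\<omega>. g (W \<omega>)) -` B \<inter> space M = W -` (g -` B \<inter> space Q) \<inter> space M"
      using measurable_space[of U M P] measurable_space[of W M Q] by auto
    have "(\<lambda>\<omega>. (U \<omega>, W \<omega>)) -` ((f -` A \<inter> space P) \<times> (g -` B \<inter> space Q)) \<inter> space M =
        (U -` (f -` A \<inter> space P) \<inter> space M) \<inter> (W -` (g -` B \<inter> space Q) \<inter> space M)"
      by auto
    then show "prob (((\<lambda>\<omega>. f (U \<omega>)) -` A \<inter> space M) \<inter> ((\<lambda>\<omega>. g (W \<omega>)) -` B \<inter> space M)) =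
        prob ((\<lambda>\<omega>. f (U \<omega>)) -` A \<inter> space M) * prob ((\<lambda>\<omega>. g (W \<omega>)) -` B \<inter> space M)"
      using indep_varD[OF indep measurable_sets[OF f \<open>A \<in> sets borel\<close>]
          measurable_sets[OF g \<open>B \<in> sets K\<close>]]
      unfolding * by (simp only:)
  qed measurable
  show ?thesis
    unfolding random_map_law_def pair[symmetric] by (subst distr_distr) (simp_all add: comp_def)
qed

section \<open>Contraction of characteristic functions\<close>

text \<open>The common frame of the beta and the gamma equation, with a known solution
  \<open>\<kappa>\<close>. No moments of \<open>\<gamma>\<close> or of the laws are assumed, so laws
  are compared through characteristic functions.\<close>

locale affine_contraction = prob_space \<nu>
  for \<nu> :: "'s measure" +
  fixes \<alpha> \<gamma> :: "'s \<Rightarrow> real" and \<Phi> :: "'s \<Rightarrow> real \<Rightarrow> real" and \<kappa> :: "real measure"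
  assumes \<alpha>_measurable [measurable]: "\<alpha> \<in> borel_measurable \<nu>"
    and \<gamma>_measurable [measurable]: "\<gamma> \<in> borel_measurable \<nu>"
    and \<Phi>_eq: "\<Phi> s x = \<alpha> s * x + \<gamma> s"
    and \<alpha>_less_1: "(\<integral>\<^sup>+s. ennreal \<bar>\<alpha> s\<bar> \<partial>\<nu>) < 1"
    and \<kappa>_fixed: "solves_random_equation \<nu> \<Phi> \<kappa>"
begin

definition rate :: real where
  "rate = (\<integral>s. \<bar>\<alpha> s\<bar> \<partial>\<nu>)"

lemma integrable_\<alpha>: "integrable \<nu> (\<lambda>s. \<bar>\<alpha> s\<bar>)"
  using \<alpha>_less_1 by (intro integrableI_bounded) (auto intro: less_trans)

lemma ennreal_rate: "ennreal rate = (\<integral>\<^sup>+s. ennreal \<bar>\<alpha> s\<bar> \<partial>\<nu>)"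
  unfolding rate_def by (intro nn_integral_eq_integral[symmetric] integrable_\<alpha>) auto

lemma rate_nonneg: "0 \<le> rate"
  by (simp add: rate_def)

lemma rate_less_1: "rate < 1"
  using \<alpha>_less_1 by (simp flip: ennreal_rate ennreal_1 add: ennreal_less_iff rate_nonneg)

lemma \<Phi>_measurable: "(\<lambda>(x, s). \<Phi> s x) \<in> borel \<Otimes>\<^sub>M \<nu> \<rightarrow>\<^sub>M borel"
  unfolding \<Phi>_eq by measurable

lemma real_distribution_\<kappa>: "real_distribution \<kappa>"
  using \<kappa>_fixed by (simp add: solves_random_equation_def)

lemma real_distribution_random_map_law:
  assumes "real_distribution \<eta>"
  shows "real_distribution (random_map_law \<nu> \<Phi> \<eta>)"
proof -
  interpret \<eta>: real_distribution \<eta> by fact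
  interpret pair_prob_space \<eta> \<nu> ..
  note [measurable] = \<Phi>_measurable
  show ?thesis unfolding random_map_law_def
    by (intro real_distribution_distr) measurable
qed

text \<open>Fubini's theorem, with \<open>s\<close> fixed in the inner integral: the slope rescales
  the argument of \<open>char \<eta>\<close> and the translation becomes a phase. The phase has
  modulus 1 and disappears from norms of differences.\<close>

lemma char_random_map_law:
  assumes "real_distribution \<eta>"
  shows "char (random_map_law \<nu> \<Phi> \<eta>) t = (\<integral>s. iexp (t * \<gamma> s) * char \<eta> (t * \<alpha> s) \<partial>\<nu>)"
proof -
  interpret \<eta>: real_distribution \<eta> by fact
  interpret pair_prob_space \<eta> \<nu> ..
  note [measurable] = \<Phi>_measurable
  have "char (random_map_law \<nu> \<Phi> \<eta>) t =
      (\<integral>z. (case z of (x, s) \<Rightarrow> iexp (t * \<gamma> s) * iexp (t * \<alpha> s * x)) \<partial>(\<eta> \<Otimes>\<^sub>M \<nu>))"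
    unfolding random_map_law_def char_def
    by (subst integral_distr)
       (auto simp: \<Phi>_eq algebra_simps split_beta simp flip: exp_add intro!: Bochner_Integration.integral_cong)
  also have "\<dots> = (\<integral>s. (\<integral>x. iexp (t * \<gamma> s) * iexp (t * \<alpha> s * x) \<partial>\<eta>) \<partial>\<nu>)"
    by (intro integral_snd[symmetric] P.integrable_const_bound[where B = 1]) (auto simp: norm_mult)
  also have "\<dots> = (\<integral>s. iexp (t * \<gamma> s) * char \<eta> (t * \<alpha> s) \<partial>\<nu>)"
    by (simp add: char_def)
  finally show ?thesis .
qed

lemma char_\<kappa>: "char \<kappa> t = (\<integral>s. iexp (t * \<gamma> s) * char \<kappa> (t * \<alpha> s) \<partial>\<nu>)"
  using \<kappa>_fixed char_random_map_law[of \<kappa> t]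
  by (simp add: solves_random_equation_def random_map_law_def)

text \<open>Near \<open>0\<close> the two characteristic functions agree up to \<open>e\<close>, and away from \<open>0\<close> a linear
  function dominates their difference; the random map then contracts the linear part.\<close>

lemma char_random_map_law_tendsto:
  assumes "real_distribution \<eta>"
  shows "(\<lambda>n. char ((random_map_law \<nu> \<Phi> ^^ n) \<eta>) t) \<longlonglongrightarrow> char \<kappa> t"
proof -
  let ?\<eta> = "\<lambda>n. (random_map_law \<nu> \<Phi> ^^ n) \<eta>"
  have rd: "real_distribution (?\<eta> n)" for n
    by (induction n) (simp_all add: assms real_distribution_random_map_law)
  interpret \<kappa>: real_distribution \<kappa> by (rule real_distribution_\<kappa>)
  interpret \<eta>: real_distribution "?\<eta> n" for n by (rule rd)
  show ?thesis
  proof (rule LIMSEQ_I)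
    fix e :: real assume "0 < e"
    have "isCont (\<lambda>t. char \<eta> t - char \<kappa> t) 0"
      using \<eta>.isCont_char[of 0 0] \<kappa>.isCont_char by (intro continuous_diff) simp_all
    from this[unfolded continuous_at_eps_delta, rule_format, OF half_gt_zero[OF \<open>0 < e\<close>]]
    obtain \<delta> where \<delta>: "0 < \<delta>" "\<And>t. \<bar>t\<bar> < \<delta> \<Longrightarrow> cmod (char \<eta> t - char \<kappa> t) < e / 2"
      using \<eta>.char_zero[of 0] \<kappa>.char_zero by (auto simp: dist_norm)
    \<comment> \<open>Two characteristic functions differ by at most 2, which is at most
      \<open>2 / \<delta> * \<bar>t\<bar>\<close> once \<open>\<bar>t\<bar> \<ge> \<delta>\<close>;
      this gives the slope. Averaging over \<open>\<nu>\<close> preserves the constant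
      \<open>e / 2\<close> and multiplies the linear term by \<open>rate\<close>.\<close>
    have "cmod (char (?\<eta> n) t - char \<kappa> t) \<le> e / 2 + 2 / \<delta> * rate ^ n * \<bar>t\<bar>" for n t
    proof (induction n arbitrary: t)
      case 0
      show ?case
      proof (cases "\<bar>t\<bar> < \<delta>")
        case True
        then have "cmod (char \<eta> t - char \<kappa> t) \<le> e / 2"
          using \<delta>(2) by (simp add: less_imp_le)
        also have "\<dots> \<le> e / 2 + 2 / \<delta> * rate ^ 0 * \<bar>t\<bar>"
          using \<delta>(1) by simp
        finally show ?thesis by simp
      next
        case False
        have "cmod (char \<eta> t - char \<kappa> t) \<le> cmod (char \<eta> t) + cmod (char \<kappa> t)"
          by (rule norm_triangle_ineq4)
        also have "\<dots> \<le> 2"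
          using \<eta>.cmod_char_le_1[of 0 t] \<kappa>.cmod_char_le_1[of t] by simp
        also have "2 \<le> 2 / \<delta> * \<bar>t\<bar>"
          using False \<delta>(1) by (simp add: field_simps)
        finally show ?thesis using \<open>0 < e\<close> by simp
      qed
    next
      case (Suc n)
      have int: "integrable \<nu> (\<lambda>s. iexp (t * \<gamma> s) * char (?\<eta> n) (t * \<alpha> s))"
          "integrable \<nu> (\<lambda>s. iexp (t * \<gamma> s) * char \<kappa> (t * \<alpha> s))"
        by (auto intro!: integrable_const_bound[where B = 1]
            simp: norm_mult \<eta>.cmod_char_le_1 \<kappa>.cmod_char_le_1)
      have "cmod (char (?\<eta> (Suc n)) t - char \<kappa> t) =
          cmod (\<integral>s. iexp (t * \<gamma> s) * char (?\<eta> n) (t * \<alpha> s) - iexp (t * \<gamma> s) * char \<kappa> (t * \<alpha> s) \<partial>\<nu>)"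
        using int by (simp add: char_random_map_law[OF rd] char_\<kappa>[of t])
      also have "\<dots> \<le> (\<integral>s. cmod (iexp (t * \<gamma> s) * char (?\<eta> n) (t * \<alpha> s) -
          iexp (t * \<gamma> s) * char \<kappa> (t * \<alpha> s)) \<partial>\<nu>)"
        by (rule integral_norm_bound)
      also have "\<dots> \<le> (\<integral>s. e / 2 + 2 / \<delta> * rate ^ n * \<bar>t\<bar> * \<bar>\<alpha> s\<bar> \<partial>\<nu>)"
      proof (rule integral_mono)
        show "integrable \<nu> (\<lambda>s. cmod (iexp (t * \<gamma> s) * char (?\<eta> n) (t * \<alpha> s) -
            iexp (t * \<gamma> s) * char \<kappa> (t * \<alpha> s)))"
          using int by (intro integrable_norm Bochner_Integration.integrable_diff)
        show "integrable \<nu> (\<lambda>s. e / 2 + 2 / \<delta> * rate ^ n * \<bar>t\<bar> * \<bar>\<alpha> s\<bar>)"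
          using integrable_\<alpha> by simp
        fix s
        have "cmod (iexp (t * \<gamma> s) * char (?\<eta> n) (t * \<alpha> s) - iexp (t * \<gamma> s) * char \<kappa> (t * \<alpha> s)) =
            cmod (char (?\<eta> n) (t * \<alpha> s) - char \<kappa> (t * \<alpha> s))"
          unfolding right_diff_distrib[symmetric] norm_mult by simp
        also have "\<dots> \<le> e / 2 + 2 / \<delta> * rate ^ n * \<bar>t * \<alpha> s\<bar>"
          by (rule Suc.IH)
        finally show "cmod (iexp (t * \<gamma> s) * char (?\<eta> n) (t * \<alpha> s) -
            iexp (t * \<gamma> s) * char \<kappa> (t * \<alpha> s)) \<le> e / 2 + 2 / \<delta> * rate ^ n * \<bar>t\<bar> * \<bar>\<alpha> s\<bar>"
          by (simp add: abs_mult mult.assoc)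
      qed
      also have "\<dots> = e / 2 + 2 / \<delta> * rate ^ n * \<bar>t\<bar> * rate"
        using integrable_\<alpha> by (simp add: rate_def prob_space)
      finally show ?case by (simp add: mult_ac)
    qed
    note bound = this
    have "(\<lambda>n. 2 / \<delta> * rate ^ n * \<bar>t\<bar>) \<longlonglongrightarrow> 2 / \<delta> * 0 * \<bar>t\<bar>"
      using rate_nonneg rate_less_1 by (intro tendsto_intros LIMSEQ_power_zero) simp
    then have "\<forall>\<^sub>F n in sequentially. 2 / \<delta> * rate ^ n * \<bar>t\<bar> < e / 2"
      using \<open>0 < e\<close> by (intro order_tendstoD(2)) auto
    then have "\<forall>\<^sub>F n in sequentially. norm (char (?\<eta> n) t - char \<kappa> t) < e"
    proof eventually_elim
      case (elim n)
      then show ?case using bound[of n t] by linarith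
    qed
    then show "\<exists>no. \<forall>n\<ge>no. norm (char (?\<eta> n) t - char \<kappa> t) < e"
      by (simp add: eventually_sequentially)
  qed
qed

text \<open>A solution is unchanged by every power of the operator, so its characteristic function
  is a constant sequence converging to that of \<open>\<kappa>\<close>.\<close>

lemma solves_iff: "solves_random_equation \<nu> \<Phi> \<eta> \<longleftrightarrow> \<eta> = \<kappa>"
proof
  assume \<eta>: "solves_random_equation \<nu> \<Phi> \<eta>"
  then have rd: "real_distribution \<eta>" and "random_map_law \<nu> \<Phi> \<eta> = \<eta>"
    by (auto simp: solves_random_equation_def random_map_law_def)
  then have "(random_map_law \<nu> \<Phi> ^^ n) \<eta> = \<eta>" for n
    by (induction n) simp_all
  then have "char \<eta> t = char \<kappa> t" for t
    using char_random_map_law_tendsto[OF rd, of t] by (simp add: LIMSEQ_const_iff)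
  then show "\<eta> = \<kappa>"
    by (intro Levy_uniqueness rd real_distribution_\<kappa>) auto
qed (simp add: \<kappa>_fixed)

end

section \<open>Iterations along an i.i.d. sequence of maps\<close>

locale iid_affine_contraction = affine_contraction \<nu> \<alpha> \<gamma> \<Phi> \<kappa> + M: prob_space M
  for \<nu> :: "'s measure" and \<alpha> \<gamma> \<Phi> \<kappa> and M :: "'w measure" +
  fixes S :: "nat \<Rightarrow> 'w \<Rightarrow> 's"
  assumes indep_S: "M.indep_vars (\<lambda>_. \<nu>) S {1..}"
    and distr_S: "1 \<le> n \<Longrightarrow> distr M \<nu> (S n) = \<nu>"
begin

lemma restrict_S_measurable: "J \<subseteq> {1..} \<Longrightarrow> (\<lambda>\<omega>. \<lambda>i\<in>J. S i \<omega>) \<in> M \<rightarrow>\<^sub>M PiM J (\<lambda>_. \<nu>)"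
  using indep_S by (intro measurable_restrict) (auto simp: M.indep_vars_def)

lemma S_measurable: "1 \<le> n \<Longrightarrow> S n \<in> M \<rightarrow>\<^sub>M \<nu>"
  using indep_S by (auto simp: M.indep_vars_def)

text \<open>Outside \<open>{1..n}\<close> the restricted family is \<open>undefined\<close>, but
  those coordinates are never read. The iterate thus becomes a function of a block to which
  \<open>indep_var_restrict\<close> applies.\<close>

lemma forward_iter_restrict:
  "forward_iter (\<lambda>i. \<Phi> ((\<lambda>i\<in>{1..n}. S i \<omega>) i)) n x = forward_iter (\<lambda>i. \<Phi> (S i \<omega>)) n x"
  by (rule arg_cong[where f = "\<lambda>h. h x"], rule forward_iter_cong) simp

lemma backward_iter_restrict:
  "backward_iter (\<lambda>i. \<Phi> ((\<lambda>i\<in>{k + 1..k + n}. S i \<omega>) (i + k))) n x =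
    backward_iter (\<lambda>i. \<Phi> (S (i + k) \<omega>)) n x"
  by (rule arg_cong[where f = "\<lambda>h. h x"], rule backward_iter_cong) simp

lemma forward_iter_rv [measurable]:
  "(\<lambda>\<omega>. forward_iter (\<lambda>i. \<Phi> (S i \<omega>)) n x) \<in> borel_measurable M"
  using measurable_compose[OF restrict_S_measurable
      forward_iter_measurable[OF \<Phi>_measurable order.refl, of n x]]
  by (simp add: forward_iter_restrict subset_iff del: restrict_apply One_nat_def)

lemma backward_iter_rv [measurable]:
  "(\<lambda>\<omega>. backward_iter (\<lambda>i. \<Phi> (S i \<omega>)) n x) \<in> borel_measurable M"
  using measurable_compose[OF restrict_S_measurable
      backward_iter_measurable[OF \<Phi>_measurable order.refl, of 0 n x]]
    backward_iter_restrict[where k = 0 and n = n and x = x]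
  by (simp add: subset_iff del: restrict_apply One_nat_def)

text \<open>The outermost map has index \<open>Suc n\<close> and is independent of the block
  \<open>{1..n}\<close> that determines the current state.\<close>

lemma distr_forward_iter:
  "distr M borel (\<lambda>\<omega>. forward_iter (\<lambda>i. \<Phi> (S i \<omega>)) n x) =
    (random_map_law \<nu> \<Phi> ^^ n) (return borel x)"
proof (induction n)
  case 0
  show ?case by (simp add: M.distr_const)
next
  case (Suc n)
  have "M.indep_var (PiM {1..n} (\<lambda>_. \<nu>)) (\<lambda>\<omega>. \<lambda>i\<in>{1..n}. S i \<omega>)
      (PiM {Suc n} (\<lambda>_. \<nu>)) (\<lambda>\<omega>. \<lambda>i\<in>{Suc n}. S i \<omega>)"
    by (rule M.indep_var_restrict[OF indep_S]) auto
  from M.distr_random_map[OF this forward_iter_measurable[OF \<Phi>_measurable order.refl, of n x]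
      measurable_component_singleton[OF singletonI, of "Suc n" "\<lambda>_. \<nu>"] \<Phi>_measurable]
  show ?case
    by (simp add: forward_iter_restrict[simplified] distr_S Suc.IH)
qed

text \<open>Here the outermost map has index \<open>Suc k\<close> and is independent of the block
  after it. The induction runs over all shifts because peeling off that map increases
  \<open>k\<close>. The resulting law is that of the forward iterate.\<close>

lemma distr_backward_iter_shift:
  "distr M borel (\<lambda>\<omega>. backward_iter (\<lambda>i. \<Phi> (S (i + k) \<omega>)) n x) =
    (random_map_law \<nu> \<Phi> ^^ n) (return borel x)"
proof (induction n arbitrary: k)
  case 0
  show ?case by (simp add: M.distr_const)
next
  case (Suc n)
  let ?J = "{Suc k + 1..Suc k + n}"
  have "M.indep_var (PiM ?J (\<lambda>_. \<nu>)) (\<lambda>\<omega>. \<lambda>i\<in>?J. S i \<omega>)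
      (PiM {Suc k} (\<lambda>_. \<nu>)) (\<lambda>\<omega>. \<lambda>i\<in>{Suc k}. S i \<omega>)"
    by (rule M.indep_var_restrict[OF indep_S]) auto
  from M.distr_random_map[OF this
      backward_iter_measurable[OF \<Phi>_measurable order.refl, of "Suc k" n x]
      measurable_component_singleton[OF singletonI, of "Suc k" "\<lambda>_. \<nu>"] \<Phi>_measurable]
  show ?case
    unfolding backward_iter_restrict
    by (simp add: distr_S Suc.IH[of "Suc k", simplified] backward_iter_Suc_shift
        del: backward_iter.simps)
qed

lemmas distr_backward_iter = distr_backward_iter_shift[where k = 0, simplified]

lemma weak_conv_forward_iter:
  "weak_conv_m (\<lambda>n. distr M borel (\<lambda>\<omega>. forward_iter (\<lambda>i. \<Phi> (S i \<omega>)) n x)) \<kappa>"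
proof (rule levy_continuity)
  show "real_distribution (distr M borel (\<lambda>\<omega>. forward_iter (\<lambda>i. \<Phi> (S i \<omega>)) n x))" for n
    by (rule M.real_distribution_distr) measurable
  have "real_distribution (return borel x)"
    by (simp add: real_distribution_def real_distribution_axioms_def prob_space_return)
  then show "(\<lambda>n. char (distr M borel (\<lambda>\<omega>. forward_iter (\<lambda>i. \<Phi> (S i \<omega>)) n x)) t) \<longlonglongrightarrow> char \<kappa> t"
    for t
    unfolding distr_forward_iter by (rule char_random_map_law_tendsto)
qed (rule real_distribution_\<kappa>)

text \<open>The characteristic functions of the backward iterates have two limits:
  \<open>char \<kappa>\<close>, since they share the laws of the forward iterates, and that of
  \<open>Y\<close>, by dominated convergence.\<close>

lemma distr_backward_limit:
  assumes [measurable]: "Y \<in> borel_measurable M"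
    and lim: "AE \<omega> in M. (\<lambda>n. backward_iter (\<lambda>i. \<Phi> (S i \<omega>)) n x) \<longlonglongrightarrow> Y \<omega>"
  shows "distr M borel Y = \<kappa>"
proof (rule Levy_uniqueness)
  show "real_distribution (distr M borel Y)"
    by (rule M.real_distribution_distr) measurable
  show "char (distr M borel Y) = char \<kappa>"
  proof
    fix t
    have "real_distribution (return borel x)"
      by (simp add: real_distribution_def real_distribution_axioms_def prob_space_return)
    then have "(\<lambda>n. char (distr M borel (\<lambda>\<omega>. backward_iter (\<lambda>i. \<Phi> (S i \<omega>)) n x)) t)
        \<longlonglongrightarrow> char \<kappa> t"
      unfolding distr_backward_iter by (rule char_random_map_law_tendsto)
    moreover have "(\<lambda>n. \<integral>\<omega>. iexp (t * backward_iter (\<lambda>i. \<Phi> (S i \<omega>)) n x) \<partial>M) \<longlonglongrightarrow>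
        (\<integral>\<omega>. iexp (t * Y \<omega>) \<partial>M)"
    proof (rule integral_dominated_convergence[where w = "\<lambda>_. 1"])
      show "AE \<omega> in M. (\<lambda>n. iexp (t * backward_iter (\<lambda>i. \<Phi> (S i \<omega>)) n x)) \<longlonglongrightarrow> iexp (t * Y \<omega>)"
        using lim by eventually_elim (intro tendsto_intros)
    qed auto
    ultimately show "char (distr M borel Y) t = char \<kappa> t"
      by (intro LIMSEQ_unique) (simp_all add: char_def integral_distr)
  qed
qed (rule real_distribution_\<kappa>)

text \<open>By independence the products have means \<open>rate ^ n\<close>, which are summable. The
  series of the products then has finite mean, so it is almost surely finite and its terms vanish in
  the limit.\<close>

lemma AE_prod_\<alpha>_tendsto_0: "AE \<omega> in M. (\<lambda>n. \<Prod>i=1..n. \<bar>\<alpha> (S i \<omega>)\<bar>) \<longlonglongrightarrow> 0"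
proof -
  have [measurable]: "(\<lambda>\<omega>. \<alpha> (S i \<omega>)) \<in> borel_measurable M" if "1 \<le> i" for i
    using measurable_compose[OF S_measurable[OF that] \<alpha>_measurable] .
  let ?P = "\<lambda>n \<omega>. \<Prod>i=1..n. \<bar>\<alpha> (S i \<omega>)\<bar>"
  have [measurable]: "?P n \<in> borel_measurable M" for n
    by (intro borel_measurable_prod) auto
  have \<alpha>_S: "(\<integral>\<^sup>+\<omega>. ennreal \<bar>\<alpha> (S i \<omega>)\<bar> \<partial>M) = ennreal rate" if "1 \<le> i" for i
  proof -
    have "(\<integral>\<^sup>+\<omega>. ennreal \<bar>\<alpha> (S i \<omega>)\<bar> \<partial>M) = (\<integral>\<^sup>+s. ennreal \<bar>\<alpha> s\<bar> \<partial>distr M \<nu> (S i))"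
      using S_measurable[OF that] by (subst nn_integral_distr) auto
    then show ?thesis by (simp add: distr_S[OF that] ennreal_rate)
  qed
  have "(\<integral>\<^sup>+\<omega>. ennreal (?P n \<omega>) \<partial>M) = ennreal (rate ^ n)" for n
  proof -
    have "M.indep_vars (\<lambda>_. borel) (\<lambda>i \<omega>. ennreal \<bar>\<alpha> (S i \<omega>)\<bar>) {1..n}"
      by (rule M.indep_vars_compose2[OF M.indep_vars_subset[OF indep_S]]) auto
    then have "(\<integral>\<^sup>+\<omega>. (\<Prod>i=1..n. ennreal \<bar>\<alpha> (S i \<omega>)\<bar>) \<partial>M) = (\<Prod>i=1..n. ennreal rate)"
      by (subst M.indep_vars_nn_integral) (auto simp: \<alpha>_S)
    then show ?thesis
      by (simp add: prod_ennreal ennreal_power rate_nonneg)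
  qed
  then have "(\<integral>\<^sup>+\<omega>. (\<Sum>n. ennreal (?P n \<omega>)) \<partial>M) = (\<Sum>n. ennreal (rate ^ n))"
    by (subst nn_integral_suminf) auto
  also have "\<dots> < \<infinity>"
    using rate_nonneg rate_less_1 by (simp add: suminf_ennreal2 summable_geometric)
  finally have "AE \<omega> in M. (\<Sum>n. ennreal (?P n \<omega>)) \<noteq> \<infinity>"
    by (intro nn_integral_PInf_AE) auto
  then show ?thesis
  proof eventually_elim
    case (elim \<omega>)
    then have "summable (\<lambda>n. ?P n \<omega>)"
      by (intro summable_suminf_not_top) (auto intro: prod_nonneg)
    then show ?case by (rule summable_LIMSEQ_zero)
  qed
qed

lemma AE_S:
  assumes "AE s in \<nu>. P s"
  shows "AE \<omega> in M. \<forall>i\<ge>1. P (S i \<omega>)"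
  unfolding AE_all_countable
proof
  fix i :: nat
  have "AE \<omega> in M. P (S i \<omega>)" if "1 \<le> i"
  proof (rule AE_distrD[OF S_measurable[OF that]])
    show "AE s in distr M \<nu> (S i). P s"
      unfolding distr_S[OF that] by (rule assms)
  qed
  then show "AE \<omega> in M. 1 \<le> i \<longrightarrow> P (S i \<omega>)" by simp
qed

text \<open>Two backward iterates differ by the product of the slopes times the distance of the
  starting points, which is at most the diameter bound \<open>D\<close>. This is the null sequence
  for \<open>uniform_limit_backward_iter\<close>.\<close>

lemma backward_iter_converges:
  assumes maps: "AE s in \<nu>. \<forall>x\<in>X. \<Phi> s x \<in> X" and X: "bounded X" "x0 \<in> X"
  shows "\<exists>Y. Y \<in> borel_measurable M \<and> distr M borel Y = \<kappa> \<and>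
    (AE \<omega> in M. uniform_limit X (backward_iter (\<lambda>i. \<Phi> (S i \<omega>))) (\<lambda>_. Y \<omega>) sequentially)"
proof -
  \<comment> \<open>\<open>lim\<close> takes some value even where the sequence diverges, so
    \<open>Y\<close> is defined and measurable on the whole space.\<close>
  define Y where "Y \<omega> = lim (\<lambda>n. backward_iter (\<lambda>i. \<Phi> (S i \<omega>)) n x0)" for \<omega>
  have Y: "Y \<in> borel_measurable M"
    unfolding Y_def by measurable
  obtain D where D: "\<forall>x\<in>X. \<forall>y\<in>X. dist x y \<le> D"
    using X(1) unfolding bounded_two_points by blast
  have unif: "AE \<omega> in M. uniform_limit X (backward_iter (\<lambda>i. \<Phi> (S i \<omega>))) (\<lambda>_. Y \<omega>) sequentially"
    using AE_S[OF maps] AE_prod_\<alpha>_tendsto_0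
  proof eventually_elim
    case (elim \<omega>)
    show ?case unfolding Y_def
    proof (rule uniform_limit_backward_iter)
      show "(\<lambda>n. (\<Prod>i=1..n. \<bar>\<alpha> (S i \<omega>)\<bar>) * D) \<longlonglongrightarrow> 0"
        using tendsto_mult_right[OF elim(2), of D] by simp
      fix n x y assume "x \<in> X" "y \<in> X"
      then have "\<bar>x - y\<bar> \<le> D"
        using D by (simp add: dist_real_def)
      then show "\<bar>backward_iter (\<lambda>i. \<Phi> (S i \<omega>)) n x - backward_iter (\<lambda>i. \<Phi> (S i \<omega>)) n y\<bar>
          \<le> (\<Prod>i=1..n. \<bar>\<alpha> (S i \<omega>)\<bar>) * D"
        unfolding backward_iter_affine_diff[where g = "\<lambda>i. \<Phi> (S i \<omega>)", OF \<Phi>_eq] abs_mult abs_prod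
        by (intro mult_left_mono prod_nonneg) auto
    qed (use elim(1) X(2) in auto)
  qed
  have "distr M borel Y = \<kappa>"
    using unif by (intro distr_backward_limit[OF Y, of x0], eventually_elim)
      (rule tendsto_uniform_limitI[OF _ X(2)])
  with Y unif show ?thesis by blast
qed

end

section \<open>The random equations\<close>

lemma beta_map_altdef: "beta_map s x = fst s * x + snd s * (1 - x)"
  by (simp add: beta_map_def split_beta)

lemma gamma_map_altdef: "gamma_map s x = fst (fst s) * x + snd (fst s) * snd s"
  by (simp add: gamma_map_def split_beta)

text \<open>In the branch of weight \<open>p\<close>, \<open>u\<close> stands for
  \<open>1 - L\<close>; in the other one, \<open>1 - u\<close> stands for \<open>R\<close>. Each
  branch contains one of the two variables only, so the formula needs their marginal laws and not
  their joint law. The law \<open>\<beta>(z, 1)\<close> is the multiplier in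
  \<open>nn_integral_beta_mult\<close>.\<close>

locale split_law = prob_space \<mu> for \<mu> :: "(real \<times> real) measure" +
  fixes p z a b :: real
  assumes p: "0 < p" "p < 1" and z: "0 < z"
    and ab: "a = (1 - p) * z" "b = p * z"
    and sets_\<mu> [measurable_cong]: "sets \<mu> = sets (borel \<Otimes>\<^sub>M borel)"
    and nn_integral_\<mu>: "f \<in> borel_measurable (borel \<Otimes>\<^sub>M borel) \<Longrightarrow> (\<integral>\<^sup>+s. f s \<partial>\<mu>) =
      ennreal p * (\<integral>\<^sup>+u. f (u, 0) \<partial>beta_law z 1) + ennreal (1 - p) * (\<integral>\<^sup>+u. f (1, 1 - u) \<partial>beta_law z 1)"
begin

lemma ab_pos: "0 < a" "0 < b" and ab_sum: "a + b = z"
  and ab_quot: "b / (a + b) = p" "a / (a + b) = 1 - p"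
  using p z by (auto simp: ab field_simps)

sublocale \<beta>: real_distribution "beta_law a b"
  by (intro real_distribution_beta_law ab_pos)

sublocale \<Gamma>a: real_distribution "gamma_law a"
  by (intro real_distribution_gamma_law ab_pos)

sublocale \<Gamma>b: real_distribution "gamma_law b"
  by (intro real_distribution_gamma_law ab_pos)

sublocale \<Gamma>z: real_distribution "gamma_law z"
  by (intro real_distribution_gamma_law z)

sublocale \<beta>z: real_distribution "beta_law z 1"
  by (intro real_distribution_beta_law z) simp

sublocale \<mu>\<Gamma>: pair_prob_space \<mu> "gamma_law b" ..

text \<open>The branches of \<open>\<mu>\<close> send \<open>x\<close> to \<open>x * u\<close> and
  to \<open>1 - (1 - x) * u\<close>. The second is the first one conjugated by the reflection, with
  \<open>a\<close> and \<open>b\<close> exchanged, so \<open>nn_integral_beta_mult\<close> handles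
  both.\<close>

lemma nn_integral_beta_fixed:
  assumes [measurable]: "f \<in> borel_measurable borel"
  shows "(\<integral>\<^sup>+x. (\<integral>\<^sup>+s. f (beta_map s x) \<partial>\<mu>) \<partial>beta_law a b) = (\<integral>\<^sup>+x. f x \<partial>beta_law a b)"
proof -
  have [measurable]: "(\<lambda>s. f (beta_map s x)) \<in> borel_measurable (borel \<Otimes>\<^sub>M borel)" for x
    by (simp add: beta_map_altdef)
  have eq: "x + (1 - x) * (1 - u) = 1 - u * (1 - x)" for x u :: real
    by (simp add: algebra_simps)
  have "(\<integral>\<^sup>+x. (\<integral>\<^sup>+s. f (beta_map s x) \<partial>\<mu>) \<partial>beta_law a b) =
      (\<integral>\<^sup>+x. ennreal p * (\<integral>\<^sup>+u. f (x * u) \<partial>beta_law z 1) +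
        ennreal (1 - p) * (\<integral>\<^sup>+u. f (1 - (1 - x) * u) \<partial>beta_law z 1) \<partial>beta_law a b)"
    by (subst nn_integral_\<mu>) (simp_all add: beta_map_altdef eq mult.commute)
  also have "\<dots> = ennreal p * (\<integral>\<^sup>+x. (\<integral>\<^sup>+u. f (x * u) \<partial>beta_law z 1) \<partial>beta_law a b) +
      ennreal (1 - p) * (\<integral>\<^sup>+x. (\<integral>\<^sup>+u. f (1 - (1 - x) * u) \<partial>beta_law z 1) \<partial>beta_law a b)"
    by (simp add: nn_integral_add nn_integral_cmult)
  also have "(\<integral>\<^sup>+x. (\<integral>\<^sup>+u. f (x * u) \<partial>beta_law z 1) \<partial>beta_law a b) =
      (\<integral>\<^sup>+x. f x \<partial>beta_law a (b + 1))"
    using nn_integral_beta_mult[of a b f] by (simp add: ab_pos ab_sum)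
  also have "(\<integral>\<^sup>+x. (\<integral>\<^sup>+u. f (1 - (1 - x) * u) \<partial>beta_law z 1) \<partial>beta_law a b) =
      (\<integral>\<^sup>+x. (\<integral>\<^sup>+u. f (1 - x * u) \<partial>beta_law z 1) \<partial>beta_law b a)"
    by (rule nn_integral_beta_law_reflect) measurable
  also have "\<dots> = (\<integral>\<^sup>+x. f (1 - x) \<partial>beta_law b (a + 1))"
    using nn_integral_beta_mult[of b a "\<lambda>x. f (1 - x)"] ab_sum by (simp add: ab_pos add.commute)
  also have "\<dots> = (\<integral>\<^sup>+x. f x \<partial>beta_law (a + 1) b)"
    by (rule nn_integral_beta_law_reflect) measurable
  finally show ?thesis
    using nn_integral_beta_law_mixture[of a b f] by (simp add: ab_pos ab_quot)
qed

lemma beta_law_solves: "solves_random_equation \<mu> beta_map (beta_law a b)"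
proof -
  have m [measurable]: "(\<lambda>(x, s). beta_map s x) \<in> borel \<Otimes>\<^sub>M (borel \<Otimes>\<^sub>M borel) \<rightarrow>\<^sub>M borel"
    by (simp add: beta_map_altdef)
  have "beta_law a b = distr (beta_law a b \<Otimes>\<^sub>M \<mu>) borel (\<lambda>(x, s). beta_map s x)"
  proof (rule measure_eqI)
    fix X assume "X \<in> sets (beta_law a b)"
    then have [measurable]: "X \<in> sets borel" by simp
    have "emeasure (distr (beta_law a b \<Otimes>\<^sub>M \<mu>) borel (\<lambda>(x, s). beta_map s x)) X =
        (\<integral>\<^sup>+y. indicator X y \<partial>distr (beta_law a b \<Otimes>\<^sub>M \<mu>) borel (\<lambda>(x, s). beta_map s x))"
      by simp
    also have "\<dots> = (\<integral>\<^sup>+w. indicator X (beta_map (snd w) (fst w)) \<partial>(beta_law a b \<Otimes>\<^sub>M \<mu>))"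
      by (subst nn_integral_distr) (simp_all add: split_beta beta_map_altdef gamma_map_altdef)
    also have "\<dots> = (\<integral>\<^sup>+x. (\<integral>\<^sup>+s. indicator X (beta_map s x) \<partial>\<mu>) \<partial>beta_law a b)"
      by (subst nn_integral_fst[symmetric]) (simp_all add: split_beta beta_map_altdef gamma_map_altdef)
    also have "\<dots> = (\<integral>\<^sup>+x. indicator X x \<partial>beta_law a b)"
      by (rule nn_integral_beta_fixed) measurable
    finally show "emeasure (beta_law a b) X =
        emeasure (distr (beta_law a b \<Otimes>\<^sub>M \<mu>) borel (\<lambda>(x, s). beta_map s x)) X"
      by simp
  qed simp
  then show ?thesis
    by (simp add: solves_random_equation_def \<beta>.real_distribution_axioms)
qed

text \<open>A gamma variable with shape \<open>z\<close> multiplies the beta equation; by the beta-gamma algebra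
  it turns \<open>(X, 1 - X)\<close> into independent gamma variables with shapes \<open>a\<close> and \<open>b\<close>.\<close>

lemma gamma_law_solves: "solves_random_equation (\<mu> \<Otimes>\<^sub>M gamma_law b) gamma_map (gamma_law a)"
proof -
  let ?\<nu> = "\<mu> \<Otimes>\<^sub>M gamma_law b"
  let ?l = "\<lambda>s v v'. fst s * v + snd s * v' :: real"
  have [measurable]:
      "(\<lambda>(x, s). gamma_map s x) \<in> borel \<Otimes>\<^sub>M ((borel \<Otimes>\<^sub>M borel) \<Otimes>\<^sub>M borel) \<rightarrow>\<^sub>M borel"
    by (simp add: gamma_map_altdef)
  have "gamma_law a = distr (gamma_law a \<Otimes>\<^sub>M ?\<nu>) borel (\<lambda>(x, s). gamma_map s x)"
  proof (rule measure_eqI)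
    fix X assume "X \<in> sets (gamma_law a)"
    then have [measurable]: "X \<in> sets borel" by simp
    let ?f = "indicator X :: real \<Rightarrow> ennreal"
    have "emeasure (distr (gamma_law a \<Otimes>\<^sub>M ?\<nu>) borel (\<lambda>(x, s). gamma_map s x)) X =
        (\<integral>\<^sup>+y. ?f y \<partial>distr (gamma_law a \<Otimes>\<^sub>M ?\<nu>) borel (\<lambda>(x, s). gamma_map s x))"
      by simp
    also have "\<dots> = (\<integral>\<^sup>+w. ?f (gamma_map (snd w) (fst w)) \<partial>(gamma_law a \<Otimes>\<^sub>M ?\<nu>))"
      by (subst nn_integral_distr) (simp_all add: split_beta beta_map_altdef gamma_map_altdef)
    also have "\<dots> = (\<integral>\<^sup>+v. (\<integral>\<^sup>+s. ?f (gamma_map s v) \<partial>?\<nu>) \<partial>gamma_law a)"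
      by (subst \<mu>\<Gamma>.P.nn_integral_fst[symmetric]) (simp_all add: split_beta beta_map_altdef gamma_map_altdef)
    also have "\<dots> = (\<integral>\<^sup>+v. (\<integral>\<^sup>+s. (\<integral>\<^sup>+v'. ?f (?l s v v') \<partial>gamma_law b) \<partial>\<mu>) \<partial>gamma_law a)"
      by (subst \<Gamma>b.nn_integral_fst[symmetric]) (simp_all add: gamma_map_altdef)
    \<comment> \<open>With \<open>s\<close> outermost, the pair \<open>(v, v')\<close> can be
      replaced by \<open>(w * x, w * (1 - x))\<close> for each fixed \<open>s\<close>. Afterwards
      \<open>s\<close> is moved back inside, to meet \<open>x\<close> in the beta equation.\<close>
    also have "\<dots> = (\<integral>\<^sup>+s. (\<integral>\<^sup>+v. (\<integral>\<^sup>+v'. ?f (?l s v v') \<partial>gamma_law b) \<partial>gamma_law a) \<partial>\<mu>)"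
      by (intro pair_sigma_finite.Fubini' pair_sigma_finite.intro) (unfold_locales, measurable)
    also have "\<dots> = (\<integral>\<^sup>+s. (\<integral>\<^sup>+w. (\<integral>\<^sup>+x. ?f (?l s (w * x) (w * (1 - x))) \<partial>beta_law a b) \<partial>gamma_law z) \<partial>\<mu>)"
    proof (rule nn_integral_cong)
      fix s :: "real \<times> real"
      show "(\<integral>\<^sup>+v. (\<integral>\<^sup>+v'. ?f (?l s v v') \<partial>gamma_law b) \<partial>gamma_law a) =
          (\<integral>\<^sup>+w. (\<integral>\<^sup>+x. ?f (?l s (w * x) (w * (1 - x))) \<partial>beta_law a b) \<partial>gamma_law z)"
        using nn_integral_beta_gamma[of a b "\<lambda>(v, v'). ?f (?l s v v')"]
        by (simp add: ab_pos ab_sum)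
    qed
    also have "\<dots> = (\<integral>\<^sup>+w. (\<integral>\<^sup>+s. (\<integral>\<^sup>+x. ?f (?l s (w * x) (w * (1 - x))) \<partial>beta_law a b) \<partial>\<mu>) \<partial>gamma_law z)"
      by (intro pair_sigma_finite.Fubini' pair_sigma_finite.intro) (unfold_locales, measurable)
    also have "\<dots> = (\<integral>\<^sup>+w. (\<integral>\<^sup>+x. (\<integral>\<^sup>+s. ?f (?l s (w * x) (w * (1 - x))) \<partial>\<mu>) \<partial>beta_law a b) \<partial>gamma_law z)"
      by (intro nn_integral_cong pair_sigma_finite.Fubini' pair_sigma_finite.intro)
        (unfold_locales, measurable)
    also have "\<dots> = (\<integral>\<^sup>+w. (\<integral>\<^sup>+x. ?f (w * x) \<partial>beta_law a b) \<partial>gamma_law z)"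
    proof (rule nn_integral_cong)
      fix w
      have "?l s (w * x) (w * (1 - x)) = w * beta_map s x" for s x
        by (simp add: beta_map_altdef algebra_simps)
      then show "(\<integral>\<^sup>+x. (\<integral>\<^sup>+s. ?f (?l s (w * x) (w * (1 - x))) \<partial>\<mu>) \<partial>beta_law a b) =
          (\<integral>\<^sup>+x. ?f (w * x) \<partial>beta_law a b)"
        using nn_integral_beta_fixed[of "\<lambda>x. ?f (w * x)"] by simp
    qed
    \<comment> \<open>The beta-gamma identity is read backwards, for a function that ignores its
      second argument.\<close>
    also have "\<dots> = (\<integral>\<^sup>+v. (\<integral>\<^sup>+v'. ?f v \<partial>gamma_law b) \<partial>gamma_law a)"
      using nn_integral_beta_gamma[of a b "\<lambda>(v, v'). ?f v"] by (simp add: ab_pos ab_sum)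
    also have "\<dots> = (\<integral>\<^sup>+v. ?f v \<partial>gamma_law a)"
      by (simp add: \<Gamma>b.emeasure_space_1[unfolded space_gamma_law])
    finally show "emeasure (gamma_law a) X =
        emeasure (distr (gamma_law a \<Otimes>\<^sub>M ?\<nu>) borel (\<lambda>(x, s). gamma_map s x)) X"
      by simp
  qed simp
  then show ?thesis
    by (simp add: solves_random_equation_def \<Gamma>a.real_distribution_axioms)
qed

lemma nn_integral_abs_beta_law: "(\<integral>\<^sup>+u. ennreal \<bar>u\<bar> \<partial>beta_law z 1) = ennreal (z / (z + 1))"
proof -
  have "(\<integral>\<^sup>+u. ennreal \<bar>u\<bar> \<partial>beta_law z 1) = (\<integral>\<^sup>+u. ennreal u \<partial>beta_law z 1)"
    using AE_beta_law[of z 1] by (intro nn_integral_cong_AE) (auto elim!: eventually_mono)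
  then show ?thesis
    using nn_integral_id_beta_law[of z 1] z by simp
qed

text \<open>The slope of \<open>beta_map (A, B)\<close> is \<open>A - B\<close>. It equals
  \<open>u\<close> in both branches of \<open>\<mu>\<close>, so its mean is
  \<open>z / (z + 1)\<close>.\<close>

sublocale beta: affine_contraction \<mu> "\<lambda>s. fst s - snd s" snd beta_map "beta_law a b"
proof
  have "(\<integral>\<^sup>+s. ennreal \<bar>fst s - snd s\<bar> \<partial>\<mu>) =
      ennreal p * ennreal (z / (z + 1)) + ennreal (1 - p) * ennreal (z / (z + 1))"
    by (subst nn_integral_\<mu>) (simp_all add: nn_integral_abs_beta_law)
  also have "\<dots> = ennreal (z / (z + 1))"
    using p z by (simp flip: distrib_right ennreal_plus)
  also have "\<dots> < 1"
    using z by (simp flip: ennreal_1 add: ennreal_less_iff)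
  finally show "(\<integral>\<^sup>+s. ennreal \<bar>fst s - snd s\<bar> \<partial>\<mu>) < 1" .
qed (simp_all add: beta_law_solves beta_map_altdef algebra_simps)

text \<open>The slope is \<open>A\<close>, which equals 1 in the branch of weight
  \<open>1 - p\<close>. The other branch has positive weight and mean slope
  \<open>z / (z + 1)\<close>, which brings the overall mean below 1.\<close>

sublocale gamma: affine_contraction "\<mu> \<Otimes>\<^sub>M gamma_law b" "\<lambda>s. fst (fst s)"
  "\<lambda>s. snd (fst s) * snd s" gamma_map "gamma_law a"
proof
  have "(\<integral>\<^sup>+s. ennreal \<bar>fst (fst s)\<bar> \<partial>(\<mu> \<Otimes>\<^sub>M gamma_law b)) = (\<integral>\<^sup>+s. ennreal \<bar>fst s\<bar> \<partial>\<mu>)"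
    by (subst \<Gamma>b.nn_integral_fst[symmetric])
      (simp_all add: \<Gamma>b.emeasure_space_1[unfolded space_gamma_law])
  also have "\<dots> = ennreal p * ennreal (z / (z + 1)) + ennreal (1 - p)"
    by (subst nn_integral_\<mu>)
      (simp_all add: nn_integral_abs_beta_law \<beta>z.emeasure_space_1[unfolded space_beta_law])
  also have "\<dots> = ennreal (p * (z / (z + 1)) + (1 - p))"
    using p z by (simp flip: ennreal_mult' ennreal_plus)
  also have "\<dots> < 1"
    using p z by (simp flip: ennreal_1 add: ennreal_less_iff field_simps)
  finally show "(\<integral>\<^sup>+s. ennreal \<bar>fst (fst s)\<bar> \<partial>(\<mu> \<Otimes>\<^sub>M gamma_law b)) < 1" .
qed (simp_all add: gamma_law_solves gamma_map_altdef)

lemma AE_\<mu>_unit_square: "AE s in \<mu>. s \<in> {0..1} \<times> {0..1}"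
proof (rule AE_I')
  let ?Q = "- ({0..1} \<times> {0..1}) :: (real \<times> real) set"
  have [measurable]: "?Q \<in> sets (borel \<Otimes>\<^sub>M borel)"
    unfolding borel_prod by (intro borel_open open_Compl closed_Times) auto
  have "(\<integral>\<^sup>+u. indicator ?Q (u, 0) \<partial>beta_law z 1) = (\<integral>\<^sup>+u. 0 \<partial>beta_law z 1)"
    "(\<integral>\<^sup>+u. indicator ?Q (1, 1 - u) \<partial>beta_law z 1) = (\<integral>\<^sup>+u. 0 \<partial>beta_law z 1)"
    by (intro nn_integral_cong_AE eventually_mono[OF AE_beta_law]; auto simp: indicator_def)+
  then have "(\<integral>\<^sup>+s. indicator ?Q s \<partial>\<mu>) = 0"
    by (subst nn_integral_\<mu>) simp_all
  then show "?Q \<in> null_sets \<mu>"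
    by (simp add: null_sets_def sets_\<mu>)
qed auto

text \<open>For \<open>x\<close> in the unit interval, \<open>beta_map\<close> forms a convex
  combination of the two coordinates of \<open>s\<close>.\<close>

lemma AE_beta_map_unit_interval: "AE s in \<mu>. \<forall>x\<in>{0..1}. beta_map s x \<in> {0..1}"
  using AE_\<mu>_unit_square
proof eventually_elim
  case (elim s)
  show ?case
  proof
    fix x :: real assume x: "x \<in> {0..1}"
    have "fst s * x + snd s * (1 - x) \<le> 1 * x + 1 * (1 - x)"
      using elim x by (intro add_mono mult_right_mono) (auto simp: mem_Times_iff)
    then show "beta_map s x \<in> {0..1}"
      using elim x by (auto simp: beta_map_altdef mem_Times_iff)
  qed
qed

end

section \<open>The law of \<open>(A, B)\<close> from its building blocks\<close>

text \<open>Independence allows integrating over the Bernoulli variable first; each of its two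
  values retains one of \<open>L\<close> and \<open>R\<close>. The reflection turns
  \<open>\<beta>(1, z)\<close> into \<open>\<beta>(z, 1)\<close>.\<close>

lemma (in prob_space) split_lawI:
  fixes p z a b :: real
  assumes p: "0 < p" "p < 1" and z: "0 < z" and ab: "a = (1 - p) * z" "b = p * z"
    and I: "I \<in> borel_measurable M" "distr M borel I = bernoulli_law p"
    and L: "L \<in> borel_measurable M" "distr M borel L = beta_law 1 z"
    and R: "R \<in> borel_measurable M" "distr M borel R = beta_law 1 z"
    and indep: "indep_set (sets (vimage_algebra (space M) I borel))
        (sets (vimage_algebra (space M) (\<lambda>\<omega>. (L \<omega>, R \<omega>)) (borel \<Otimes>\<^sub>M borel)))"
  shows "split_law (distr M (borel \<Otimes>\<^sub>M borel)
    (\<lambda>\<omega>. I \<omega> *\<^sub>R (1 - L \<omega>, 0) + (1 - I \<omega>) *\<^sub>R (1, R \<omega>))) p z a b"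
    (is "split_law (distr M _ ?AB) p z a b")
proof -
  note [measurable] = I(1) L(1) R(1)
  let ?LR = "\<lambda>\<omega>. (L \<omega>, R \<omega>)"
  let ?law = "distr M (borel \<Otimes>\<^sub>M borel) ?LR"
  have "distr M (borel \<Otimes>\<^sub>M (borel \<Otimes>\<^sub>M borel)) (\<lambda>\<omega>. (I \<omega>, ?LR \<omega>)) = distr M borel I \<Otimes>\<^sub>M ?law"
  proof (rule distr_pair_eqI)
    fix A B assume "A \<in> sets (borel :: real measure)"
      "B \<in> sets (borel \<Otimes>\<^sub>M borel :: (real \<times> real) measure)"
    then show "prob ((I -` A \<inter> space M) \<inter> (?LR -` B \<inter> space M)) =
        prob (I -` A \<inter> space M) * prob (?LR -` B \<inter> space M)"
      by (intro indep_setD[OF indep] in_vimage_algebra)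
  qed measurable
  then have pair: "distr M (borel \<Otimes>\<^sub>M (borel \<Otimes>\<^sub>M borel)) (\<lambda>\<omega>. (I \<omega>, ?LR \<omega>)) =
      bernoulli_law p \<Otimes>\<^sub>M ?law"
    by (simp add: I(2))
  interpret law: prob_space ?law
    by (rule prob_space_distr) measurable
  have AB: "?AB = (\<lambda>\<omega>. (I \<omega> * (1 - L \<omega>) + (1 - I \<omega>), (1 - I \<omega>) * R \<omega>))"
    by (auto simp: fun_eq_iff)
  have [measurable]: "?AB \<in> M \<rightarrow>\<^sub>M borel \<Otimes>\<^sub>M borel"
    unfolding AB by measurable
  have "(\<integral>\<^sup>+s. f s \<partial>distr M (borel \<Otimes>\<^sub>M borel) ?AB) =
      ennreal p * (\<integral>\<^sup>+u. f (u, 0) \<partial>beta_law z 1) +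
      ennreal (1 - p) * (\<integral>\<^sup>+u. f (1, 1 - u) \<partial>beta_law z 1)"
    if [measurable]: "f \<in> borel_measurable (borel \<Otimes>\<^sub>M borel)" for f
  proof -
    let ?g = "\<lambda>(i, l, r). f (i * (1 - l) + (1 - i), (1 - i) * r)"
    have "(\<integral>\<^sup>+s. f s \<partial>distr M (borel \<Otimes>\<^sub>M borel) ?AB) = (\<integral>\<^sup>+\<omega>. ?g (I \<omega>, ?LR \<omega>) \<partial>M)"
      unfolding AB by (subst nn_integral_distr) simp_all
    also have "\<dots> = (\<integral>\<^sup>+x. ?g x \<partial>distr M (borel \<Otimes>\<^sub>M (borel \<Otimes>\<^sub>M borel)) (\<lambda>\<omega>. (I \<omega>, ?LR \<omega>)))"
      by (subst nn_integral_distr) simp_all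
    also have "\<dots> = (\<integral>\<^sup>+i. (\<integral>\<^sup>+y. ?g (i, y) \<partial>?law) \<partial>bernoulli_law p)"
      unfolding pair
      by (subst law.nn_integral_fst[symmetric]) (simp_all add: bernoulli_law_def cong: measurable_cong_sets)
    also have "\<dots> = ennreal p * (\<integral>\<^sup>+y. ?g (1, y) \<partial>?law) + ennreal (1 - p) * (\<integral>\<^sup>+y. ?g (0, y) \<partial>?law)"
      unfolding bernoulli_law_def using p
      by (subst nn_integral_distr) (simp_all add: mult.commute)
    also have "(\<integral>\<^sup>+y. ?g (1, y) \<partial>?law) = (\<integral>\<^sup>+u. f (1 - u, 0) \<partial>distr M borel L)"
      by (simp add: nn_integral_distr)
    also have "\<dots> = (\<integral>\<^sup>+u. f (u, 0) \<partial>beta_law z 1)"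
      unfolding L(2) by (rule nn_integral_beta_law_reflect) measurable
    also have "(\<integral>\<^sup>+y. ?g (0, y) \<partial>?law) = (\<integral>\<^sup>+u. f (1, u) \<partial>distr M borel R)"
      by (simp add: nn_integral_distr)
    also have "\<dots> = (\<integral>\<^sup>+u. f (1, 1 - u) \<partial>beta_law z 1)"
      unfolding R(2) by (rule nn_integral_beta_law_reflect[symmetric]) measurable
    finally show ?thesis .
  qed
  moreover have "prob_space (distr M (borel \<Otimes>\<^sub>M borel) ?AB)"
    by (rule prob_space_distr) measurable
  ultimately show ?thesis
    using p z ab by (simp add: split_law_def split_law_axioms_def)
qed

text \<open>Independence depends on the sigma-algebra of the target only. This bridges the Borel
  products of the hypotheses and the locale, where the law itself is the target space.\<close>

lemma (in prob_space) indep_vars_cong_sets: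
  assumes "sets K = sets L"
  shows "indep_vars (\<lambda>_. K) X I \<longleftrightarrow> indep_vars (\<lambda>_. L) X I"
  unfolding indep_vars_def2 measurable_cong_sets[OF refl assms] assms ..

theorem theorem2:
  fixes p z a b :: real
    and M\<^sub>0 :: "'s measure" and Ip L R :: "'s \<Rightarrow> real"
    and N :: "'t measure" and A B :: "'t \<Rightarrow> real"
    and M :: "'w measure" and As Bs Vs :: "nat \<Rightarrow> 'w \<Rightarrow> real"
    and \<mu> :: "(real \<times> real) measure"
  assumes p: "0 < p" "p < 1" and z: "z > 0"
    and ab: "a = (1 - p) * z" "b = p * z"
    \<comment> \<open>the building blocks \<open>Ip\<close>, \<open>(L, R)\<close>\<close>
    and M0: "prob_space M\<^sub>0"
    and Ip: "Ip \<in> borel_measurable M\<^sub>0" "distr M\<^sub>0 borel Ip = bernoulli_law p"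
    and L: "L \<in> borel_measurable M\<^sub>0" "distr M\<^sub>0 borel L = beta_law 1 z"
    and R: "R \<in> borel_measurable M\<^sub>0" "distr M\<^sub>0 borel R = beta_law 1 z"
    and LR: "\<And>\<omega>. \<omega> \<in> space M\<^sub>0 \<Longrightarrow> (L \<omega>, R \<omega>) \<in> {0..<1} \<times> {0..<1}"
    and indep: "prob_space.indep_set M\<^sub>0
                (sets (vimage_algebra (space M\<^sub>0) Ip borel))
                (sets (vimage_algebra (space M\<^sub>0) (\<lambda>\<omega>. (L \<omega>, R \<omega>)) (borel \<Otimes>\<^sub>M borel)))"
    \<comment> \<open>\<open>(A, B)\<close> and its law \<open>\<mu>\<close>\<close>
    and N: "prob_space N"
    and AB: "A \<in> borel_measurable N" "B \<in> borel_measurable N"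
    and \<mu>: "\<mu> = distr N (borel \<Otimes>\<^sub>M borel) (\<lambda>\<omega>. (A \<omega>, B \<omega>))"
    and AB_eq: "\<mu> = distr M\<^sub>0 (borel \<Otimes>\<^sub>M borel)
                  (\<lambda>\<omega>. Ip \<omega> *\<^sub>R (1 - L \<omega>, 0) + (1 - Ip \<omega>) *\<^sub>R (1, R \<omega>))"
    \<comment> \<open>the i.i.d. sequence \<open>((A\<^sub>n, B\<^sub>n), V\<^sub>n)\<close>, \<open>n \<ge> 1\<close>\<close>
    and M: "prob_space M"
    and iid_indep: "prob_space.indep_vars M (\<lambda>_. (borel \<Otimes>\<^sub>M borel) \<Otimes>\<^sub>M borel)
                      (\<lambda>n \<omega>. ((As n \<omega>, Bs n \<omega>), Vs n \<omega>)) {1..}"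
    and iid_law: "\<And>n. n \<ge> 1 \<Longrightarrow>
          distr M ((borel \<Otimes>\<^sub>M borel) \<Otimes>\<^sub>M borel) (\<lambda>\<omega>. ((As n \<omega>, Bs n \<omega>), Vs n \<omega>))
            = \<mu> \<Otimes>\<^sub>M gamma_law b"
  defines "F \<equiv> \<lambda>\<omega> n. beta_map (As n \<omega>, Bs n \<omega>)"
    and "G \<equiv> \<lambda>\<omega> n. gamma_map ((As n \<omega>, Bs n \<omega>), Vs n \<omega>)"
  shows "(\<forall>\<eta>. solves_random_equation (\<mu> \<Otimes>\<^sub>M gamma_law b) gamma_map \<eta> \<longleftrightarrow> \<eta> = gamma_law a)
    \<and> (\<forall>\<eta>. solves_random_equation \<mu> beta_map \<eta> \<longleftrightarrow> \<eta> = beta_law a b)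
    \<and> (\<exists>Y. Y \<in> borel_measurable M \<and> distr M borel Y = beta_law a b \<and>
          (AE \<omega> in M. uniform_limit {0..1} (\<lambda>n. backward_iter (F \<omega>) n) (\<lambda>x. Y \<omega>) sequentially))
    \<and> (\<forall>x\<in>{0..1}. weak_conv_m (\<lambda>n. distr M borel (\<lambda>\<omega>. forward_iter (F \<omega>) n x)) (beta_law a b))
    \<and> (\<forall>x'\<in>{0<..}. weak_conv_m (\<lambda>n. distr M borel (\<lambda>\<omega>. forward_iter (G \<omega>) n x')) (gamma_law a))"
proof -
  interpret M0: prob_space M\<^sub>0 by (rule M0)
  interpret M: prob_space M by (rule M)
  interpret split_law \<mu> p z a b
    unfolding AB_eq by (rule M0.split_lawI) fact+
  let ?K = "(borel \<Otimes>\<^sub>M borel) \<Otimes>\<^sub>M borel :: ((real \<times> real) \<times> real) measure"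
  let ?S = "\<lambda>n \<omega>. (As n \<omega>, Bs n \<omega>)" and ?T = "\<lambda>n \<omega>. ((As n \<omega>, Bs n \<omega>), Vs n \<omega>)"
  have sets_K: "sets ?K = sets (\<mu> \<Otimes>\<^sub>M gamma_law b)"
    by (intro sets_pair_measure_cong) (simp_all add: sets_\<mu>)
  interpret G: iid_affine_contraction "\<mu> \<Otimes>\<^sub>M gamma_law b" "\<lambda>s. fst (fst s)"
    "\<lambda>s. snd (fst s) * snd s" gamma_map "gamma_law a" M ?T
  proof
    show "M.indep_vars (\<lambda>_. \<mu> \<Otimes>\<^sub>M gamma_law b) ?T {1..}"
      using iid_indep unfolding M.indep_vars_cong_sets[OF sets_K] .
    show "distr M (\<mu> \<Otimes>\<^sub>M gamma_law b) (?T n) = \<mu> \<Otimes>\<^sub>M gamma_law b" if "1 \<le> n" for n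
      using iid_law[OF that] distr_cong[OF refl sets_K, of M "?T n" "?T n"] by simp
  qed
  interpret F: iid_affine_contraction \<mu> "\<lambda>s. fst s - snd s" snd beta_map "beta_law a b" M ?S
  proof
    \<comment> \<open>The sequence driving \<open>F\<close> is the first projection of the one
      driving \<open>G\<close>; it inherits independence, and its law is the first marginal of
      \<open>\<mu> \<Otimes>\<^sub>M gamma_law b\<close>.\<close>
    have "M.indep_vars (\<lambda>_. \<mu>) (\<lambda>n \<omega>. fst (?T n \<omega>)) {1..}"
      by (rule M.indep_vars_compose2[OF G.indep_S]) measurable
    then show "M.indep_vars (\<lambda>_. \<mu>) ?S {1..}" by simp
    show "distr M \<mu> (?S n) = \<mu>" if "1 \<le> n" for n
    proof -
      have "distr M \<mu> (?S n) = distr (distr M (\<mu> \<Otimes>\<^sub>M gamma_law b) (?T n)) \<mu> fst"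
        using G.S_measurable[OF that] by (subst distr_distr) (simp_all add: comp_def)
      also have "\<dots> = distr (\<mu> \<Otimes>\<^sub>M gamma_law b) \<mu> fst"
        by (simp only: G.distr_S[OF that])
      also have "\<dots> = \<mu>"
        by (rule \<Gamma>b.distr_pair_fst)
      finally show ?thesis .
    qed
  qed
  have bounded: "bounded {0..1::real}" by simp
  show ?thesis
    unfolding F_def G_def
  proof (intro conjI allI ballI)
    show "\<exists>Y. Y \<in> borel_measurable M \<and> distr M borel Y = beta_law a b \<and>
        (AE \<omega> in M. uniform_limit {0..1}
          (\<lambda>n. backward_iter (\<lambda>n. beta_map (As n \<omega>, Bs n \<omega>)) n) (\<lambda>x. Y \<omega>) sequentially)"
      by (rule F.backward_iter_converges[OF AE_beta_map_unit_interval bounded, of 0]) simp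
  qed (rule gamma.solves_iff beta.solves_iff F.weak_conv_forward_iter G.weak_conv_forward_iter)+
qed

end
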